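(* Let $t\geq 4$ and let $\gamma_1,\gamma_2\ge 0$, $\delta_1,\delta_2\geq 1$ be integers with $\gamma_1+2\delta_1=\gamma_2+2\delta_2=t+1$. For every pair of integers $(\gamma,\delta)$ with $$\delta\in\{\max(\delta_1,\delta_2),\ldots,\delta_1+\delta_2-1\}$$ and $$\max\big(\delta,\max(\gamma_1+\delta_1,\gamma_2+\delta_2)\big)\leq\gamma+\delta\leq\gamma_1+\gamma_2+\delta_1+\delta_2-1,$$ there exist two quaternary linear perfect codes $\mathcal{C}_1,\mathcal{C}_2\subseteq\mathbb{Z}_4^{2^{t-1}}$ of dual type $(0,2^{t-1};\gamma_1,\delta_1)$ and $(0,2^{t-1};\gamma_2,\delta_2)$, respectively, such that $\mathcal{C}_1\cap\mathcal{C}_2$ is a quaternary linear code of dual type $(0,2^{t-1};\gamma,\delta)$.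
   Context: A quaternary linear code of length $\beta$ is a subgroup $\mathcal{C}$ of $\mathbb{Z}_4^{\beta}$; it is of type $(0,\beta;\gamma,\delta)$ if $\mathcal{C}\cong\mathbb{Z}_2^\gamma\times\mathbb{Z}_4^\delta$ as a group. Its dual is $\mathcal{C}^\perp=\{u\in\mathbb{Z}_4^\beta:\sum_j u_jv_j=0\in\mathbb{Z}_4 \text{ for all } v\in\mathcal{C}\}$, and $\mathcal{C}$ is of dual type $(0,\beta;\gamma,\delta)$ if $\mathcal{C}^\perp$ is of type $(0,\beta;\gamma,\delta)$. The Gray map $\phi:\mathbb{Z}_4^{\beta}\to\mathbb{Z}_2^{2\beta}$ applies coordinatewise $0\mapsto(0,0),\ 1\mapsto(0,1),\ 2\mapsto(1,1),\ 3\mapsto(1,0)$. A quaternary linear perfect code of length $\beta=2^{t-1}$ is a quaternary linear code $\mathcal{C}\subseteq\mathbb{Z}_4^\beta$ such that $\phi(\mathcal{C})$ has the parameters of an extended perfect binary code: length $2^t$, $2^{2^t-t-1}$ codewords, minimum Hamming distance $4$. Standing convention: the all-ones vector $(1,\ldots,1)\in\mathbb{Z}_4^\beta$ belongs to $\mathcal{C}^\perp$ for every quaternary linear perfect code $\mathcal{C}$ (codes are considered up to coordinate permutation, not sign changes). *)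

theory Defs
  imports "HOL-Algebra.Algebra"
begin

abbreviation Z2_pow :: "nat \<Rightarrow> (nat \<Rightarrow> int) monoid" where
  "Z2_pow n \<equiv> product_group {..<n} (\<lambda>_. integer_mod_group 2)"

abbreviation Z4_pow :: "nat \<Rightarrow> (nat \<Rightarrow> int) monoid" where
  "Z4_pow n \<equiv> product_group {..<n} (\<lambda>_. integer_mod_group 4)"

definition quaternary_linear_code :: "nat \<Rightarrow> (nat \<Rightarrow> int) set \<Rightarrow> bool" where
  "quaternary_linear_code \<beta> C \<longleftrightarrow> subgroup C (Z4_pow \<beta>)"

text \<open>The binary length is always 0 here, so \<^term>\<open>of_type \<beta> C \<gamma> \<delta>\<close> is "type
  \<open>(0, \<beta>; \<gamma>, \<delta>)\<close>".\<close>

definition of_type :: "nat \<Rightarrow> (nat \<Rightarrow> int) set \<Rightarrow> nat \<Rightarrow> nat \<Rightarrow> bool" where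
  "of_type \<beta> C \<gamma> \<delta> \<longleftrightarrow> quaternary_linear_code \<beta> C \<and>
     (Z4_pow \<beta>)\<lparr>carrier := C\<rparr> \<cong> Z2_pow \<gamma> \<times>\<times> Z4_pow \<delta>"

text \<open>Residues are represented by integers in \<open>{0..<4}\<close>, so the inner product in
  \<open>\<int>/4\<close> is the integer one reduced modulo 4.\<close>

definition dual_code :: "nat \<Rightarrow> (nat \<Rightarrow> int) set \<Rightarrow> (nat \<Rightarrow> int) set" where
  "dual_code \<beta> C = {u \<in> carrier (Z4_pow \<beta>). \<forall>v\<in>C. (\<Sum>j<\<beta>. u j * v j) mod 4 = 0}"

definition of_dual_type :: "nat \<Rightarrow> (nat \<Rightarrow> int) set \<Rightarrow> nat \<Rightarrow> nat \<Rightarrow> bool" where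
  "of_dual_type \<beta> C \<gamma> \<delta> \<longleftrightarrow>
     quaternary_linear_code \<beta> C \<and> of_type \<beta> (dual_code \<beta> C) \<gamma> \<delta>"

definition gray_digit :: "int \<Rightarrow> int \<times> int" where
  "gray_digit a =
     (if a = 0 then (0, 0) else if a = 1 then (0, 1) else if a = 2 then (1, 1) else (1, 0))"

text \<open>The two bits of coordinate \<open>j\<close> are placed at positions \<open>2 * j\<close> and \<open>2 * j + 1\<close>.\<close>

definition gray_map :: "nat \<Rightarrow> (nat \<Rightarrow> int) \<Rightarrow> (nat \<Rightarrow> int)" where
  "gray_map \<beta> v = (\<lambda>k\<in>{..<2 * \<beta>}.
     if even k then fst (gray_digit (v (k div 2))) else snd (gray_digit (v (k div 2))))"

definition hamming_distance :: "nat \<Rightarrow> (nat \<Rightarrow> int) \<Rightarrow> (nat \<Rightarrow> int) \<Rightarrow> nat" where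
  "hamming_distance n x y = card {k \<in> {..<n}. x k \<noteq> y k}"

text \<open>Only meaningful for a code with at least two codewords.\<close>

definition minimum_distance :: "nat \<Rightarrow> (nat \<Rightarrow> int) set \<Rightarrow> nat" where
  "minimum_distance n A = Min {hamming_distance n x y | x y. x \<in> A \<and> y \<in> A \<and> x \<noteq> y}"

definition extended_perfect_parameters :: "nat \<Rightarrow> (nat \<Rightarrow> int) set \<Rightarrow> bool" where
  "extended_perfect_parameters t A \<longleftrightarrow>
     A \<subseteq> carrier (Z2_pow (2 ^ t)) \<and> card A = 2 ^ (2 ^ t - t - 1) \<and> minimum_distance (2 ^ t) A = 4"

definition all_ones :: "nat \<Rightarrow> nat \<Rightarrow> int" where
  "all_ones \<beta> = (\<lambda>j\<in>{..<\<beta>}. 1)"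

text \<open>The last conjunct is a normalisation: codes are considered up to coordinate permutations
  but not up to sign changes, and the all-ones vector is required to be in the dual.\<close>

definition quaternary_linear_perfect_code :: "nat \<Rightarrow> (nat \<Rightarrow> int) set \<Rightarrow> bool" where
  "quaternary_linear_perfect_code t C \<longleftrightarrow>
     quaternary_linear_code (2 ^ (t - 1)) C \<and>
     extended_perfect_parameters t (gray_map (2 ^ (t - 1)) ` C) \<and>
     all_ones (2 ^ (t - 1)) \<in> dual_code (2 ^ (t - 1)) C"

end

theory Submission
  imports Defs Complex_Main
begin

text \<open>
  Character sums give \<open>C\<^sup>\<bottom>\<^sup>\<bottom> = C\<close>, so \<open>(C\<^sub>1 \<inter> C\<^sub>2)\<^sup>\<bottom> = C\<^sub>1\<^sup>\<bottom> + C\<^sub>2\<^sup>\<bottom>\<close> and the task is to place two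
  quaternary Hadamard codes so that their sum has the prescribed type. Put \<open>m = t - 1\<close> and
  identify the coordinates with the points of the cube \<open>{0, 1}\<^sup>m\<close>. A Hadamard code is spanned by
  the all-ones vector, by digits \<open>u\<^sub>l + 2 u\<^bsub>h l\<^esub>\<close> pairing low bits with high bits, and by \<open>2 u\<^sub>k\<close> for
  the remaining bits \<open>k\<close>. Choosing which bits are low and high in the two codes, with as many
  common high bits as possible, gives every \<open>\<delta>\<close> together with the smallest possible \<open>\<gamma>\<close>. Each
  further unit of \<open>\<gamma>\<close> is gained by relabelling the points of the second code by a transposition
  along one bit direction: this adds to the sum twice the indicator of the two moved points, and
  these indicators are independent of each other and of all affine functions.
\<close>

text \<open>The sum of the duals is never formed: the intersection is rewritten as one code with
  independent checks, and counting these gives its dual type. Put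
  \<open>d\<^sub>1 = \<delta>\<^sub>1 - 1\<close> and
  \<open>d\<^sub>2 = \<delta>\<^sub>2 - 1\<close>, with \<open>d\<^sub>2 \<le> d\<^sub>1\<close>;
  the all-ones vector accounts for the missing 1. With \<open>b\<close> common low bits,
  \<open>s\<close> common high bits and a set \<open>K\<close> of transposed directions, the count
  is \<open>\<delta> = d\<^sub>1 + d\<^sub>2 - b + 1\<close> and
  \<open>\<gamma> = m - s - (d\<^sub>1 + d\<^sub>2 - b) + card K\<close>. The least \<gamma>
  reflects that \<open>s\<close> is at most \<open>d\<^sub>2\<close> and at most the number of bits
  that are low in neither code. For the greatest, a direction \<open>k\<close> is used only where
  both duals contain \<open>2 u\<^sub>k\<close>, or both contain the same digit with high bit
  \<open>k\<close>; along a common low bit the gain would have order four and raise \<delta>. This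
  leaves \<open>m + s - d\<^sub>1 - d\<^sub>2\<close> directions, exactly what the upper bound asks
  for. From \<open>t \<ge> 4\<close> comes \<open>m \<ge> 3\<close>, which keeps the transposed
  pairs disjoint and leaves a third bit besides any two.\<close>

abbreviation dot :: "nat \<Rightarrow> (nat \<Rightarrow> int) \<Rightarrow> (nat \<Rightarrow> int) \<Rightarrow> int" where
  "dot \<beta> u f \<equiv> (\<Sum>x<\<beta>. u x * f x)"

section \<open>Residue vectors modulo 4 and linear codes\<close>

lemma carrier_Z4_pow: "carrier (Z4_pow \<beta>) = {..<\<beta>} \<rightarrow>\<^sub>E {0..<4}"
  by (simp add: carrier_integer_mod_group)

lemma card_Z4_pow: "card (carrier (Z4_pow \<beta>)) = 4 ^ \<beta>"
  unfolding carrier_Z4_pow by (simp add: card_PiE)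

lemma finite_Z4_pow: "finite (carrier (Z4_pow \<beta>))"
  unfolding carrier_Z4_pow by (intro finite_PiE) auto

lemma finite_code: "quaternary_linear_code \<beta> C \<Longrightarrow> finite C"
  unfolding quaternary_linear_code_def using finite_Z4_pow finite_subset subgroup.subset by metis

lemma code_subset: "quaternary_linear_code \<beta> C \<Longrightarrow> C \<subseteq> carrier (Z4_pow \<beta>)"
  unfolding quaternary_linear_code_def by (rule subgroup.subset)

lemma mult_Z4_pow: "u \<otimes>\<^bsub>Z4_pow \<beta>\<^esub> v = (\<lambda>x\<in>{..<\<beta>}. (u x + v x) mod 4)"
  by simp

lemma inv_Z4_pow:
  assumes "u \<in> carrier (Z4_pow \<beta>)"
  shows "inv\<^bsub>Z4_pow \<beta>\<^esub> u = (\<lambda>x\<in>{..<\<beta>}. (- u x) mod 4)"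
proof -
  have "inv\<^bsub>Z4_pow \<beta>\<^esub> u = (\<lambda>x\<in>{..<\<beta>}. inv\<^bsub>integer_mod_group 4\<^esub> u x)"
    using assms by (intro inv_product_group) auto
  also have "\<dots> = (\<lambda>x\<in>{..<\<beta>}. (- u x) mod 4)"
    using assms by (intro restrict_ext, subst inv_integer_mod_group) auto
  finally show ?thesis .
qed

lemma quaternary_linear_codeI:
  assumes "C \<subseteq> carrier (Z4_pow \<beta>)" "C \<noteq> {}"
    and "\<And>u v. u \<in> C \<Longrightarrow> v \<in> C \<Longrightarrow> (\<lambda>x\<in>{..<\<beta>}. (u x + v x) mod 4) \<in> C"
    and "\<And>u. u \<in> C \<Longrightarrow> (\<lambda>x\<in>{..<\<beta>}. (- u x) mod 4) \<in> C"
  shows "quaternary_linear_code \<beta> C"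
  unfolding quaternary_linear_code_def
proof (rule group.subgroupI)
  show "group (Z4_pow \<beta>)"
    by simp
  show "inv\<^bsub>Z4_pow \<beta>\<^esub> u \<in> C" if "u \<in> C" for u
    using that assms by (subst inv_Z4_pow) auto
  show "u \<otimes>\<^bsub>Z4_pow \<beta>\<^esub> v \<in> C" if "u \<in> C" "v \<in> C" for u v
    using that assms(3) by simp
qed (use assms in auto)

lemma zero_in_code: "quaternary_linear_code \<beta> C \<Longrightarrow> (\<lambda>x\<in>{..<\<beta>}. 0) \<in> C"
  unfolding quaternary_linear_code_def using subgroup.one_closed by fastforce

lemma add_in_code:
  assumes "quaternary_linear_code \<beta> C" "u \<in> C" "v \<in> C"
  shows "(\<lambda>x\<in>{..<\<beta>}. (u x + v x) mod 4) \<in> C"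
  using assms unfolding quaternary_linear_code_def
  by (metis mult_Z4_pow subgroup.m_closed)

lemma code_carrier: "quaternary_linear_code \<beta> (carrier (Z4_pow \<beta>))"
  unfolding quaternary_linear_code_def by (rule group.subgroup_self) simp

text \<open>The sums below are the form to which the simplifier reduces
  \<^term>\<open>dot \<beta> (\<lambda>x\<in>{..<\<beta>}. f x mod 4) v\<close>.\<close>

lemma dot_mod:
  assumes "n dvd 4"
  shows "(\<Sum>x<\<beta>. f x mod 4 * v x) mod n = dot \<beta> f v mod n"
proof -
  have *: "(f x mod 4 * v x) mod n = (f x * v x) mod n" for x
  proof -
    have "(f x mod 4 mod n * v x) mod n = (f x mod n * v x) mod n"
      by (simp only: mod_mod_cancel[OF assms])
    then show ?thesis
      by (simp only: mod_mult_left_eq)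
  qed
  have "(\<Sum>x<\<beta>. f x mod 4 * v x) mod n = (\<Sum>x<\<beta>. (f x mod 4 * v x) mod n) mod n"
    by (simp add: mod_sum_eq)
  also have "\<dots> = (\<Sum>x<\<beta>. (f x * v x) mod n) mod n"
    by (simp only: *)
  finally show ?thesis
    by (simp add: mod_sum_eq)
qed

lemma dot_add_mod:
  "n dvd 4 \<Longrightarrow> (\<Sum>x<\<beta>. (u x + v x) mod 4 * w x) mod n = (dot \<beta> u w + dot \<beta> v w) mod n"
  by (simp add: dot_mod sum.distrib distrib_right)

lemma dot_minus_mod:
  "n dvd 4 \<Longrightarrow> (\<Sum>x<\<beta>. (- u x) mod 4 * w x) mod n = (- dot \<beta> u w) mod n"
  by (simp add: dot_mod sum_negf)

lemma code_dual: "quaternary_linear_code \<beta> (dual_code \<beta> C)"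
proof (rule quaternary_linear_codeI)
  have "(\<lambda>x\<in>{..<\<beta>}. 0) \<in> dual_code \<beta> C"
    by (auto simp: dual_code_def carrier_Z4_pow)
  then show "dual_code \<beta> C \<noteq> {}" by auto
next
  fix u v assume *: "u \<in> dual_code \<beta> C" "v \<in> dual_code \<beta> C"
  then have "(dot \<beta> u w + dot \<beta> v w) mod 4 = 0" if "w \<in> C" for w
    using that unfolding dual_code_def by (simp add: mod_eq_0_iff_dvd)
  then show "(\<lambda>x\<in>{..<\<beta>}. (u x + v x) mod 4) \<in> dual_code \<beta> C"
    unfolding dual_code_def by (auto simp: dot_add_mod carrier_Z4_pow simp del: carrier_product_group)
next
  fix u assume *: "u \<in> dual_code \<beta> C"
  then have "(- dot \<beta> u w) mod 4 = 0" if "w \<in> C" for w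
    using that unfolding dual_code_def by (auto simp: mod_eq_0_iff_dvd)
  then show "(\<lambda>x\<in>{..<\<beta>}. (- u x) mod 4) \<in> dual_code \<beta> C"
    unfolding dual_code_def by (auto simp: dot_minus_mod carrier_Z4_pow simp del: carrier_product_group)
qed (auto simp: dual_code_def)

subsection \<open>Character sums and duality\<close>

definition quartic_char :: "int \<Rightarrow> complex" where
  "quartic_char a = \<i> powi a"

lemma quartic_char_add: "quartic_char (a + b) = quartic_char a * quartic_char b"
  by (simp add: quartic_char_def power_int_add)

lemma quartic_char_mod: "quartic_char (a mod 4) = quartic_char a"
proof -
  have "quartic_char a = quartic_char (a div 4 * 4 + a mod 4)"
    by simp
  also have "\<dots> = quartic_char (4 * (a div 4)) * quartic_char (a mod 4)"
    by (simp only: quartic_char_add mult.commute)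
  also have "quartic_char (4 * (a div 4)) = (\<i> powi 4) powi (a div 4)"
    unfolding quartic_char_def by (rule power_int_mult)
  also have "\<i> powi 4 = 1"
    by (simp add: power4_eq_xxxx)
  finally show ?thesis by simp
qed

lemma quartic_char_eq_1_iff: "quartic_char a = 1 \<longleftrightarrow> a mod 4 = 0"
proof -
  have "a mod 4 = 0 \<or> a mod 4 = 1 \<or> a mod 4 = 2 \<or> a mod 4 = 3" by presburger
  moreover have "quartic_char 0 = 1" "quartic_char 1 = \<i>" "quartic_char 2 = -1" "quartic_char 3 = -\<i>"
    by (auto simp: quartic_char_def power3_eq_cube)
  moreover have "\<i> \<noteq> 1" "- \<i> \<noteq> 1" "(-1::complex) \<noteq> 1"
    by (auto simp: complex_eq_iff)
  ultimately show ?thesis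
    using quartic_char_mod[of a] by auto
qed

lemma quartic_char_cong: "a mod 4 = b mod 4 \<Longrightarrow> quartic_char a = quartic_char b"
  by (metis quartic_char_mod)

text \<open>Orthogonality of characters: translation by a word \<open>w\<close> of \<open>C\<close>
  that fails the check permutes \<open>C\<close> and multiplies the sum by
  \<open>quartic_char (dot \<beta> u w)\<close>, which is not 1, so the sum vanishes.\<close>

lemma sum_quartic_char_code:
  assumes C: "quaternary_linear_code \<beta> C"
  shows "(\<Sum>v\<in>C. quartic_char (dot \<beta> u v)) =
    (if \<forall>v\<in>C. dot \<beta> u v mod 4 = 0 then of_nat (card C) else 0)"
proof (cases "\<forall>v\<in>C. dot \<beta> u v mod 4 = 0")
  case True
  then have "(\<Sum>v\<in>C. quartic_char (dot \<beta> u v)) = (\<Sum>v\<in>C. 1)"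
    by (intro sum.cong) (auto simp: quartic_char_eq_1_iff)
  then show ?thesis using True by simp
next
  case False
  then obtain w where w: "w \<in> C" "dot \<beta> u w mod 4 \<noteq> 0" by blast
  let ?sh = "\<lambda>v. \<lambda>x\<in>{..<\<beta>}. (v x + w x) mod 4"
  have inj: "inj_on ?sh C"
  proof (rule inj_onI)
    fix v v' assume v: "v \<in> C" "v' \<in> C" and eq: "?sh v = ?sh v'"
    have vG: "v \<in> {..<\<beta>} \<rightarrow>\<^sub>E {0..<4}" and v'G: "v' \<in> {..<\<beta>} \<rightarrow>\<^sub>E {0..<4}"
      using v C code_subset carrier_Z4_pow by blast+
    then show "v = v'"
    proof (rule PiE_ext)
      fix x assume x: "x \<in> {..<\<beta>}"
      then have "(v x + w x) mod 4 = (v' x + w x) mod 4"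
        using eq by (metis (mono_tags, lifting) restrict_apply')
      then have "v x mod 4 = v' x mod 4"
        by (simp add: mod_eq_dvd_iff)
      moreover have "v x \<in> {0..<4}" "v' x \<in> {0..<4}"
        using PiE_mem[OF vG x] PiE_mem[OF v'G x] by auto
      ultimately show "v x = v' x"
        by simp
    qed
  qed
  moreover have "?sh ` C \<subseteq> C"
    using add_in_code[OF C] w(1) by blast
  ultimately have "?sh ` C = C"
    using finite_code[OF C] by (simp add: endo_inj_surj)
  with inj have "bij_betw ?sh C C"
    by (simp add: bij_betw_def)
  then have "(\<Sum>v\<in>C. quartic_char (dot \<beta> u v)) = (\<Sum>v\<in>C. quartic_char (dot \<beta> u (?sh v)))"
    by (rule sum.reindex_bij_betw[symmetric])
  also have "\<dots> = (\<Sum>v\<in>C. quartic_char (dot \<beta> u v) * quartic_char (dot \<beta> u w))"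
  proof (rule sum.cong[OF refl])
    fix v
    have "dot \<beta> u (?sh v) mod 4 = (dot \<beta> u v + dot \<beta> u w) mod 4"
      using dot_add_mod[where n=4 and u=v and v=w and w=u] by (simp add: mult.commute)
    then show "quartic_char (dot \<beta> u (?sh v)) = quartic_char (dot \<beta> u v) * quartic_char (dot \<beta> u w)"
      unfolding quartic_char_add[symmetric] by (rule quartic_char_cong)
  qed
  also have "\<dots> = (\<Sum>v\<in>C. quartic_char (dot \<beta> u v)) * quartic_char (dot \<beta> u w)"
    by (simp add: sum_distrib_right)
  finally have "(\<Sum>v\<in>C. quartic_char (dot \<beta> u v)) = 0"
    using w(2) by (auto simp: quartic_char_eq_1_iff)
  then show ?thesis unfolding if_not_P[OF False] .
qed

text \<open>The double character sum is evaluated in both orders. Summed over \<open>C\<close>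
  first, it counts the dual; summed over the whole space first, only the zero word survives, because
  unit vectors detect every nonzero coordinate.\<close>

lemma card_code_dual:
  assumes C: "quaternary_linear_code \<beta> C"
  shows "card C * card (dual_code \<beta> C) = 4 ^ \<beta>"
proof -
  let ?G = "carrier (Z4_pow \<beta>)" and ?z = "\<lambda>x\<in>{..<\<beta>}. 0 :: int"
  let ?S = "\<Sum>u\<in>?G. \<Sum>v\<in>C. quartic_char (dot \<beta> u v)"
  have "?S = (\<Sum>u\<in>?G. if u \<in> dual_code \<beta> C then of_nat (card C) else 0)"
    using C by (intro sum.cong) (auto simp: sum_quartic_char_code dual_code_def)
  also have "\<dots> = of_nat (card C * card (dual_code \<beta> C))"
    using finite_Z4_pow by (subst sum.inter_filter[symmetric])
      (auto simp: dual_code_def intro!: arg_cong[where f=card])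
  finally have 1: "?S = of_nat (card C * card (dual_code \<beta> C))" .
  have "?S = (\<Sum>v\<in>C. \<Sum>u\<in>?G. quartic_char (dot \<beta> v u))"
    by (subst sum.swap) (simp add: mult.commute)
  also have "\<dots> = (\<Sum>v\<in>C. if v = ?z then 4 ^ \<beta> else 0)"
  proof (rule sum.cong[OF refl])
    fix v assume v: "v \<in> C"
    then have vG: "v \<in> {..<\<beta>} \<rightarrow>\<^sub>E {0..<4}"
      using C code_subset carrier_Z4_pow by blast
    have "(\<forall>u\<in>?G. dot \<beta> v u mod 4 = 0) \<longleftrightarrow> v = ?z"
    proof
      assume *: "\<forall>u\<in>?G. dot \<beta> v u mod 4 = 0"
      have "v x = ?z x" if x: "x < \<beta>" for x
      proof -
        let ?e = "\<lambda>y\<in>{..<\<beta>}. of_bool (y = x) :: int"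
        have "?e \<in> ?G" by (auto simp: carrier_Z4_pow simp del: carrier_product_group)
        then have "dot \<beta> v ?e mod 4 = 0" using * by blast
        moreover have "dot \<beta> v ?e = (\<Sum>y<\<beta>. if y = x then v x else 0)"
          by (intro sum.cong) auto
        ultimately have "v x mod 4 = 0" using x by simp
        moreover have "v x \<in> {0..<4}" using PiE_mem[OF vG, of x] x by simp
        ultimately show ?thesis using x by simp
      qed
      moreover have "?z \<in> {..<\<beta>} \<rightarrow>\<^sub>E {0..<4}" by auto
      ultimately show "v = ?z" using vG by (intro PiE_ext[of v]) auto
    qed simp
    then show "(\<Sum>u\<in>?G. quartic_char (dot \<beta> v u)) = (if v = ?z then 4 ^ \<beta> else 0)"
      by (simp only: sum_quartic_char_code[OF code_carrier] card_Z4_pow of_nat_power of_nat_numeral)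
  qed
  also have "\<dots> = 4 ^ \<beta>"
    using zero_in_code[OF C] finite_code[OF C] by simp
  finally have "(of_nat (card C * card (dual_code \<beta> C)) :: complex) = of_nat (4 ^ \<beta>)"
    using 1 by simp
  then show ?thesis by (simp only: of_nat_eq_iff)
qed

text \<open>One inclusion is immediate, and \<open>card_code_dual\<close> applied to
  \<open>C\<close> and to its dual forces equal sizes.\<close>

lemma dual_dual_code:
  assumes C: "quaternary_linear_code \<beta> C"
  shows "dual_code \<beta> (dual_code \<beta> C) = C"
proof (rule sym, rule card_subset_eq)
  show "finite (dual_code \<beta> (dual_code \<beta> C))"
    by (rule finite_code[OF code_dual])
  show "C \<subseteq> dual_code \<beta> (dual_code \<beta> C)"
    using code_subset[OF C] by (auto simp: dual_code_def mult.commute)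
  have "card (dual_code \<beta> C) * card C = card (dual_code \<beta> C) * card (dual_code \<beta> (dual_code \<beta> C))"
    using card_code_dual[OF C] card_code_dual[OF code_dual, of \<beta> C] by (simp add: mult.commute)
  moreover have "card (dual_code \<beta> C) \<noteq> 0"
    using card_code_dual[OF C] by (metis mult_is_0 power_not_zero zero_neq_numeral)
  ultimately show "card C = card (dual_code \<beta> (dual_code \<beta> C))"
    by simp
qed

subsection \<open>Codes given by independent parity checks\<close>

text \<open>A check by \<open>G j\<close> modulo 2 is orthogonality to \<open>2 * G j\<close> modulo
  4. Thus \<open>I\<close> is meant to index generators of order four of the dual, and
  \<open>J\<close> generators of order two.\<close>

definition parity_check_code ::
    "nat \<Rightarrow> 'i set \<Rightarrow> ('i \<Rightarrow> nat \<Rightarrow> int) \<Rightarrow> 'j set \<Rightarrow> ('j \<Rightarrow> nat \<Rightarrow> int) \<Rightarrow> (nat \<Rightarrow> int) set" where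
  "parity_check_code \<beta> I F J G = {u \<in> carrier (Z4_pow \<beta>).
     (\<forall>i\<in>I. dot \<beta> u (F i) mod 4 = 0) \<and> (\<forall>j\<in>J. dot \<beta> u (G j) mod 2 = 0)}"

definition comb ::
    "nat \<Rightarrow> 'i set \<Rightarrow> ('i \<Rightarrow> nat \<Rightarrow> int) \<Rightarrow> 'j set \<Rightarrow> ('j \<Rightarrow> nat \<Rightarrow> int) \<Rightarrow>
      ('i \<Rightarrow> int) \<Rightarrow> ('j \<Rightarrow> int) \<Rightarrow> nat \<Rightarrow> int" where
  "comb \<beta> I F J G w z =
     (\<lambda>x\<in>{..<\<beta>}. ((\<Sum>i\<in>I. w i * F i x) + 2 * (\<Sum>j\<in>J. z j * G j x)) mod 4)"

definition span_code ::
    "nat \<Rightarrow> 'i set \<Rightarrow> ('i \<Rightarrow> nat \<Rightarrow> int) \<Rightarrow> 'j set \<Rightarrow> ('j \<Rightarrow> nat \<Rightarrow> int) \<Rightarrow> (nat \<Rightarrow> int) set" where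
  "span_code \<beta> I F J G = {comb \<beta> I F J G w z | w z. True}"

text \<open>Joint linear independence over the field with two elements. The order-two generators
  enter without their factor 2, so that this single condition yields a direct sum decomposition
  modulo 4.\<close>

definition independent_mod_2 ::
    "nat \<Rightarrow> 'i set \<Rightarrow> ('i \<Rightarrow> nat \<Rightarrow> int) \<Rightarrow> 'j set \<Rightarrow> ('j \<Rightarrow> nat \<Rightarrow> int) \<Rightarrow> bool" where
  "independent_mod_2 \<beta> I F J G \<longleftrightarrow>
     (\<forall>a c. (\<forall>x<\<beta>. even ((\<Sum>i\<in>I. a i * F i x) + (\<Sum>j\<in>J. c j * G j x))) \<longrightarrow>
       (\<forall>i\<in>I. even (a i)) \<and> (\<forall>j\<in>J. even (c j)))"

lemma comb_add:
  "(\<lambda>x\<in>{..<\<beta>}. (comb \<beta> I F J G w z x + comb \<beta> I F J G w' z' x) mod 4) =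
   comb \<beta> I F J G (\<lambda>i. w i + w' i) (\<lambda>j. z j + z' j)"
  unfolding comb_def
  by (rule restrict_ext) (simp add: mod_add_eq sum.distrib algebra_simps)

lemma comb_minus:
  "(\<lambda>x\<in>{..<\<beta>}. (- comb \<beta> I F J G w z x) mod 4) =
   comb \<beta> I F J G (\<lambda>i. - w i) (\<lambda>j. - z j)"
  unfolding comb_def
  by (rule restrict_ext) (simp add: mod_minus_eq sum_negf)

lemma comb_cong:
  assumes "\<And>i. i \<in> I \<Longrightarrow> w i mod 4 = w' i mod 4" "\<And>j. j \<in> J \<Longrightarrow> z j mod 2 = z' j mod 2"
  shows "comb \<beta> I F J G w z = comb \<beta> I F J G w' z'"
  unfolding comb_def
proof (rule restrict_ext)
  fix x
  have "4 dvd (\<Sum>i\<in>I. (w i - w' i) * F i x)"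
    using assms(1) by (intro dvd_sum dvd_mult2) (simp add: mod_eq_dvd_iff)
  moreover have "2 dvd (\<Sum>j\<in>J. (z j - z' j) * G j x)"
    using assms(2) by (intro dvd_sum dvd_mult2) (simp add: mod_eq_dvd_iff)
  then have "2 * 2 dvd 2 * (\<Sum>j\<in>J. (z j - z' j) * G j x)"
    by (rule mult_dvd_mono[OF dvd_refl])
  ultimately have "4 dvd (\<Sum>i\<in>I. (w i - w' i) * F i x) + 2 * (\<Sum>j\<in>J. (z j - z' j) * G j x)"
    by (simp add: dvd_add)
  then show "((\<Sum>i\<in>I. w i * F i x) + 2 * (\<Sum>j\<in>J. z j * G j x)) mod 4 =
      ((\<Sum>i\<in>I. w' i * F i x) + 2 * (\<Sum>j\<in>J. z' j * G j x)) mod 4"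
    by (simp add: mod_eq_dvd_iff sum_subtractf algebra_simps)
qed

text \<open>Independence is used twice. Modulo 2 the \<open>G\<close> part drops out through its
  factor 2, so the \<open>F\<close> coefficients are even; after division by 2, the halved
  \<open>F\<close> coefficients and the \<open>G\<close> coefficients occur together and are even as
  well.\<close>

lemma comb_inject:
  assumes indep: "independent_mod_2 \<beta> I F J G"
    and eq: "comb \<beta> I F J G w z = comb \<beta> I F J G w' z'"
  shows "\<forall>i\<in>I. w i mod 4 = w' i mod 4" "\<forall>j\<in>J. z j mod 2 = z' j mod 2"
proof -
  define a where "a i = w i - w' i" for i
  define c where "c j = z j - z' j" for j
  have dvd: "4 dvd (\<Sum>i\<in>I. a i * F i x) + 2 * (\<Sum>j\<in>J. c j * G j x)" if "x < \<beta>" for x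
    using fun_cong[OF eq, of x] that
    by (simp add: comb_def a_def c_def mod_eq_dvd_iff sum_subtractf algebra_simps)
  have "even (\<Sum>i\<in>I. a i * F i x)" if "x < \<beta>" for x
    using dvd_trans[OF _ dvd[OF that], of 2] by simp
  then have a: "\<forall>i\<in>I. even (a i)"
    using indep[unfolded independent_mod_2_def, rule_format, of a "\<lambda>_. 0"] by simp
  have "even ((\<Sum>i\<in>I. a i div 2 * F i x) + (\<Sum>j\<in>J. c j * G j x))" if "x < \<beta>" for x
  proof -
    have "(\<Sum>i\<in>I. a i * F i x) = 2 * (\<Sum>i\<in>I. a i div 2 * F i x)"
      using a by (simp add: sum_distrib_left mult.assoc[symmetric])
    then have "2 * 2 dvd 2 * ((\<Sum>i\<in>I. a i div 2 * F i x) + (\<Sum>j\<in>J. c j * G j x))"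
      using dvd[OF that] by (simp add: distrib_left)
    then show ?thesis
      by (subst (asm) dvd_mult_cancel_left) simp
  qed
  then have *: "(\<forall>i\<in>I. even (a i div 2)) \<and> (\<forall>j\<in>J. even (c j))"
    using indep[unfolded independent_mod_2_def, rule_format, of "\<lambda>i. a i div 2" c] by simp
  have "4 dvd a i" if "i \<in> I" for i
  proof -
    have "a i = 2 * (a i div 2)" using a that by simp
    moreover have "2 * 2 dvd 2 * (a i div 2)"
      using * that by (intro mult_dvd_mono) auto
    ultimately show ?thesis by simp
  qed
  then show "\<forall>i\<in>I. w i mod 4 = w' i mod 4"
    by (simp add: a_def mod_eq_dvd_iff)
  show "\<forall>j\<in>J. z j mod 2 = z' j mod 2"
    using * by (simp add: c_def mod_eq_dvd_iff)
qed

lemma code_span: "quaternary_linear_code \<beta> (span_code \<beta> I F J G)"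
proof (rule quaternary_linear_codeI)
  show "span_code \<beta> I F J G \<subseteq> carrier (Z4_pow \<beta>)"
    unfolding carrier_Z4_pow by (auto simp: span_code_def comb_def)
  show "span_code \<beta> I F J G \<noteq> {}"
    by (auto simp: span_code_def)
  show "(\<lambda>x\<in>{..<\<beta>}. (u x + v x) mod 4) \<in> span_code \<beta> I F J G"
    if "u \<in> span_code \<beta> I F J G" "v \<in> span_code \<beta> I F J G" for u v
    using that comb_add[of \<beta> I F J G] unfolding span_code_def by fastforce
  show "(\<lambda>x\<in>{..<\<beta>}. (- u x) mod 4) \<in> span_code \<beta> I F J G"
    if "u \<in> span_code \<beta> I F J G" for u
    using that comb_minus[of \<beta> I F J G] unfolding span_code_def by fastforce
qed

lemma dot_comb:
  "dot \<beta> u (comb \<beta> I F J G w z) mod 4 =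
   ((\<Sum>i\<in>I. w i * dot \<beta> u (F i)) + 2 * (\<Sum>j\<in>J. z j * dot \<beta> u (G j))) mod 4"
proof -
  have "dot \<beta> u (comb \<beta> I F J G w z) =
      (\<Sum>x<\<beta>. ((\<Sum>i\<in>I. w i * F i x) + 2 * (\<Sum>j\<in>J. z j * G j x)) mod 4 * u x)"
    unfolding comb_def by (intro sum.cong) auto
  then have "dot \<beta> u (comb \<beta> I F J G w z) mod 4 =
      (\<Sum>x<\<beta>. ((\<Sum>i\<in>I. w i * F i x) + 2 * (\<Sum>j\<in>J. z j * G j x)) * u x) mod 4"
    by (simp only: dot_mod dvd_refl)
  also have "(\<Sum>x<\<beta>. ((\<Sum>i\<in>I. w i * F i x) + 2 * (\<Sum>j\<in>J. z j * G j x)) * u x) =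
      (\<Sum>x<\<beta>. \<Sum>i\<in>I. w i * (u x * F i x)) + 2 * (\<Sum>x<\<beta>. \<Sum>j\<in>J. z j * (u x * G j x))"
  proof -
    have "((\<Sum>i\<in>I. w i * F i x) + 2 * (\<Sum>j\<in>J. z j * G j x)) * u x =
        (\<Sum>i\<in>I. w i * (u x * F i x)) + 2 * (\<Sum>j\<in>J. z j * (u x * G j x))" for x
      by (simp add: distrib_left sum_distrib_left mult_ac)
    then show ?thesis
      by (simp only: sum.distrib sum_distrib_left)
  qed
  also have "\<dots> = (\<Sum>i\<in>I. w i * dot \<beta> u (F i)) + 2 * (\<Sum>j\<in>J. z j * dot \<beta> u (G j))"
    by (simp add: sum.swap[of _ "{..<\<beta>}"] sum_distrib_left)
  finally show ?thesis .
qed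

lemma dual_span_code:
  assumes "finite I" "finite J"
  shows "dual_code \<beta> (span_code \<beta> I F J G) = parity_check_code \<beta> I F J G"
proof (intro equalityI subsetI)
  fix u assume u: "u \<in> dual_code \<beta> (span_code \<beta> I F J G)"
  have *: "((\<Sum>i\<in>I. w i * dot \<beta> u (F i)) + 2 * (\<Sum>j\<in>J. z j * dot \<beta> u (G j))) mod 4 = 0" for w z
    using u unfolding dual_code_def span_code_def dot_comb[symmetric] by blast
  have "dot \<beta> u (F i) mod 4 = 0" if "i \<in> I" for i
    using *[of "\<lambda>k. of_bool (k = i)" "\<lambda>_. 0"] that assms(1)
    by (simp add: of_bool_def if_distrib[of "\<lambda>a. a * _"] cong: if_cong)
  moreover have "dot \<beta> u (G j) mod 2 = 0" if "j \<in> J" for j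
  proof -
    have "(2 * dot \<beta> u (G j)) mod (2 * 2) = 0"
      using *[of "\<lambda>_. 0" "\<lambda>k. of_bool (k = j)"] that assms(2)
      by (simp add: of_bool_def if_distrib[of "\<lambda>a. a * _"] cong: if_cong)
    then show ?thesis
      by (simp only: mod_mult_mult1 mult_eq_0_iff) simp
  qed
  ultimately show "u \<in> parity_check_code \<beta> I F J G"
    using u by (simp add: parity_check_code_def dual_code_def)
next
  fix u assume u: "u \<in> parity_check_code \<beta> I F J G"
  have "dot \<beta> u (comb \<beta> I F J G w z) mod 4 = 0" for w z
  proof -
    have "4 dvd (\<Sum>i\<in>I. w i * dot \<beta> u (F i))"
      using u by (intro dvd_sum, intro dvd_mult) (auto simp: parity_check_code_def)
    moreover have "2 * 2 dvd 2 * (\<Sum>j\<in>J. z j * dot \<beta> u (G j))"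
      using u by (intro mult_dvd_mono[OF dvd_refl] dvd_sum, intro dvd_mult) (auto simp: parity_check_code_def)
    ultimately show ?thesis
      unfolding dot_comb by (simp add: dvd_add)
  qed
  then show "u \<in> dual_code \<beta> (span_code \<beta> I F J G)"
    using u by (auto simp: parity_check_code_def dual_code_def span_code_def)
qed

text \<open>The isomorphism sends coefficient vectors, reindexed by \<open>p\<close> and
  \<open>q\<close>, to their combinations. By \<open>comb_cong\<close> reducing coefficients is
  harmless, and \<open>comb_inject\<close> gives injectivity.\<close>

lemma of_type_span_code:
  assumes fin: "finite I" "finite J" and indep: "independent_mod_2 \<beta> I F J G"
  shows "of_type \<beta> (span_code \<beta> I F J G) (card J) (card I)"
proof -
  let ?P = "Z2_pow (card J) \<times>\<times> Z4_pow (card I)"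
  let ?D = "(Z4_pow \<beta>)\<lparr>carrier := span_code \<beta> I F J G\<rparr>"
  obtain p where p: "bij_betw p I {..<card I}"
    using ex_bij_betw_finite_nat[OF fin(1)] by (auto simp: atLeast0LessThan)
  obtain q where q: "bij_betw q J {..<card J}"
    using ex_bij_betw_finite_nat[OF fin(2)] by (auto simp: atLeast0LessThan)
  have pI: "p i < card I" if "i \<in> I" for i using p that bij_betwE by blast
  have qJ: "q j < card J" if "j \<in> J" for j using q that bij_betwE by blast
  have car: "carrier ?P = ({..<card J} \<rightarrow>\<^sub>E {0..<2}) \<times> ({..<card I} \<rightarrow>\<^sub>E {0..<4})"
    by (simp add: DirProd_def carrier_integer_mod_group)
  define h where "h = (\<lambda>(z, w). comb \<beta> I F J G (\<lambda>i. w (p i)) (\<lambda>j. z (q j)))"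
  have "h \<in> hom ?P ?D"
  proof (rule homI)
    fix a assume "a \<in> carrier ?P"
    show "h a \<in> carrier ?D"
      by (auto simp: h_def span_code_def split: prod.split)
  next
    fix a b assume "a \<in> carrier ?P" "b \<in> carrier ?P"
    obtain z w z' w' where ab: "a = (z, w)" "b = (z', w')" by fastforce
    have "h (a \<otimes>\<^bsub>?P\<^esub> b) = comb \<beta> I F J G (\<lambda>i. w (p i) + w' (p i)) (\<lambda>j. z (q j) + z' (q j))"
      unfolding h_def ab by (simp, rule comb_cong) (auto simp: pI qJ)
    also have "\<dots> = h a \<otimes>\<^bsub>?D\<^esub> h b"
      by (simp add: h_def ab comb_add)
    finally show "h (a \<otimes>\<^bsub>?P\<^esub> b) = h a \<otimes>\<^bsub>?D\<^esub> h b" .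
  qed
  moreover have "inj_on h (carrier ?P)"
  proof (rule inj_onI)
    fix a b assume ca: "a \<in> carrier ?P" and cb: "b \<in> carrier ?P" and eq: "h a = h b"
    obtain z w z' w' where ab: "a = (z, w)" "b = (z', w')" by fastforce
    have zw: "z \<in> {..<card J} \<rightarrow>\<^sub>E {0..<2}" "w \<in> {..<card I} \<rightarrow>\<^sub>E {0..<4}"
      using ca unfolding car ab by auto
    have zw': "z' \<in> {..<card J} \<rightarrow>\<^sub>E {0..<2}" "w' \<in> {..<card I} \<rightarrow>\<^sub>E {0..<4}"
      using cb unfolding car ab by auto
    note * = comb_inject[OF indep eq[unfolded ab h_def prod.case]]
    have "w = w'"
    proof (rule PiE_ext[OF zw(2) zw'(2)])
      fix k assume k: "k \<in> {..<card I}"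
      then have "w k mod 4 = w' k mod 4"
        using *(1) bij_betw_imp_surj_on[OF p] by (metis imageE)
      then show "w k = w' k"
        using PiE_mem[OF zw(2) k] PiE_mem[OF zw'(2) k] by simp
    qed
    moreover have "z = z'"
    proof (rule PiE_ext[OF zw(1) zw'(1)])
      fix k assume k: "k \<in> {..<card J}"
      then have "z k mod 2 = z' k mod 2"
        using *(2) bij_betw_imp_surj_on[OF q] by (metis imageE)
      then show "z k = z' k"
        using PiE_mem[OF zw(1) k] PiE_mem[OF zw'(1) k] by simp
    qed
    ultimately show "a = b" by (simp add: ab)
  qed
  moreover have "h ` carrier ?P = span_code \<beta> I F J G"
  proof (intro equalityI subsetI)
    fix v assume "v \<in> span_code \<beta> I F J G"
    then obtain w z where v: "v = comb \<beta> I F J G w z" by (auto simp: span_code_def)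
    define w' where "w' = (\<lambda>k\<in>{..<card I}. w (inv_into I p k) mod 4)"
    define z' where "z' = (\<lambda>k\<in>{..<card J}. z (inv_into J q k) mod 2)"
    have "h (z', w') = v"
      unfolding h_def v prod.case
      by (rule comb_cong) (auto simp: w'_def z'_def pI qJ bij_betw_inv_into_left[OF p] bij_betw_inv_into_left[OF q])
    moreover have "(z', w') \<in> carrier ?P"
      unfolding car by (auto simp: w'_def z'_def)
    ultimately show "v \<in> h ` carrier ?P" by blast
  qed (auto simp: h_def span_code_def)
  ultimately have "h \<in> iso ?P ?D"
    by (simp add: iso_def bij_betw_def)
  moreover have "group ?P"
    by (intro DirProd_group) auto
  ultimately have "?D \<cong> ?P"
    by (meson group.iso_sym is_isoI)
  then show ?thesis
    unfolding of_type_def using code_span by blast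
qed

lemma card_of_type:
  assumes "of_type \<beta> C \<gamma> \<delta>"
  shows "card C = 2 ^ (\<gamma> + 2 * \<delta>)"
proof -
  obtain f where "f \<in> iso ((Z4_pow \<beta>)\<lparr>carrier := C\<rparr>) (Z2_pow \<gamma> \<times>\<times> Z4_pow \<delta>)"
    using assms unfolding of_type_def is_iso_def by blast
  then have "bij_betw f C (carrier (Z2_pow \<gamma> \<times>\<times> Z4_pow \<delta>))"
    by (simp add: iso_def)
  then have "card C = card (carrier (Z2_pow \<gamma> \<times>\<times> Z4_pow \<delta>))"
    by (rule bij_betw_same_card)
  also have "\<dots> = 2 ^ \<gamma> * 4 ^ \<delta>"
    by (simp add: DirProd_def carrier_integer_mod_group card_cartesian_product card_PiE)
  finally show ?thesis
    by (simp add: power_add power_mult)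
qed

text \<open>The span of the checks has this code as its dual, hence by double duality it is the dual
  of this code. Its type is then the dual type, and its size determines the number of
  codewords.\<close>

lemma parity_check_code:
  assumes "finite I" "finite J" "independent_mod_2 \<beta> I F J G"
  shows "quaternary_linear_code \<beta> (parity_check_code \<beta> I F J G)"
    and "of_dual_type \<beta> (parity_check_code \<beta> I F J G) (card J) (card I)"
    and "card (parity_check_code \<beta> I F J G) * 2 ^ (card J + 2 * card I) = 4 ^ \<beta>"
proof -
  let ?D = "span_code \<beta> I F J G" and ?C = "parity_check_code \<beta> I F J G"
  have dual: "dual_code \<beta> ?D = ?C"
    using assms(1,2) by (rule dual_span_code)
  show "quaternary_linear_code \<beta> ?C"
    using code_dual[of \<beta> ?D] by (simp add: dual)
  moreover have "dual_code \<beta> ?C = ?D"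
    using dual_dual_code[OF code_span] by (metis dual)
  moreover have type: "of_type \<beta> ?D (card J) (card I)"
    using assms by (rule of_type_span_code)
  ultimately show "of_dual_type \<beta> ?C (card J) (card I)"
    by (simp add: of_dual_type_def)
  show "card ?C * 2 ^ (card J + 2 * card I) = 4 ^ \<beta>"
    using card_code_dual[OF code_span, of \<beta> I F J G] by (simp add: dual card_of_type[OF type] mult.commute)
qed

subsection \<open>Perfect codes from parity checks\<close>

text \<open>The Lee metric, expressed through Gray digits so that the isometry of the Gray map is a
  mere regrouping of bit positions.\<close>

definition lee_distance :: "int \<Rightarrow> int \<Rightarrow> nat" where
  "lee_distance a b = of_bool (fst (gray_digit a) \<noteq> fst (gray_digit b)) +
     of_bool (snd (gray_digit a) \<noteq> snd (gray_digit b))"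

lemma residue_4_cases:
  "a \<in> {0..<4::int} \<Longrightarrow> a = 0 \<or> a = 1 \<or> a = 2 \<or> a = 3"
  by auto

lemma lee_distance_eq_0_iff:
  assumes "a \<in> {0..<4}" "b \<in> {0..<4}"
  shows "lee_distance a b = 0 \<longleftrightarrow> a = b"
  using residue_4_cases[OF assms(1)] residue_4_cases[OF assms(2)]
  by (auto simp: lee_distance_def gray_digit_def)

lemma lee_distance_mod_2:
  assumes "a \<in> {0..<4}" "b \<in> {0..<4}"
  shows "even (lee_distance a b) \<longleftrightarrow> even (a - b)"
  using residue_4_cases[OF assms(1)] residue_4_cases[OF assms(2)]
  by (auto simp: lee_distance_def gray_digit_def)

lemma lee_distance_eq_2:
  assumes "a \<in> {0..<4}" "b \<in> {0..<4}" "lee_distance a b = 2"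
  shows "(a - b) mod 4 = 2"
  using residue_4_cases[OF assms(1)] residue_4_cases[OF assms(2)] assms(3)
  by (auto simp: lee_distance_def gray_digit_def)

lemma sum_pairs: "(\<Sum>k<2 * n. f k) = (\<Sum>j<n. f (2 * j) + f (Suc (2 * j)))"
  for f :: "nat \<Rightarrow> nat"
  by (induction n) auto

lemma hamming_distance_gray_map:
  "hamming_distance (2 * \<beta>) (gray_map \<beta> u) (gray_map \<beta> v) = (\<Sum>j<\<beta>. lee_distance (u j) (v j))"
proof -
  have "hamming_distance (2 * \<beta>) (gray_map \<beta> u) (gray_map \<beta> v) =
      (\<Sum>k<2 * \<beta>. of_bool (gray_map \<beta> u k \<noteq> gray_map \<beta> v k))"
    by (simp add: hamming_distance_def Int_def)
  also have "\<dots> = (\<Sum>j<\<beta>. lee_distance (u j) (v j))"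
    unfolding sum_pairs by (intro sum.cong) (auto simp: gray_map_def lee_distance_def)
  finally show ?thesis .
qed

lemma inj_on_gray_map: "inj_on (gray_map \<beta>) (carrier (Z4_pow \<beta>))"
proof (rule inj_onI)
  fix u v assume u: "u \<in> carrier (Z4_pow \<beta>)" and v: "v \<in> carrier (Z4_pow \<beta>)"
    and "gray_map \<beta> u = gray_map \<beta> v"
  then have "(\<Sum>j<\<beta>. lee_distance (u j) (v j)) = 0"
    by (simp flip: hamming_distance_gray_map add: hamming_distance_def)
  then have *: "lee_distance (u j) (v j) = 0" if "j < \<beta>" for j
    using that by simp
  show "u = v"
    using u v unfolding carrier_Z4_pow
  proof (rule PiE_ext)
    fix j assume j: "j \<in> {..<\<beta>}"
    then show "u j = v j"
      using * PiE_mem[OF u[unfolded carrier_Z4_pow] j] PiE_mem[OF v[unfolded carrier_Z4_pow] j]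
        lee_distance_eq_0_iff by blast
  qed
qed

text \<open>Lee distance 2 would need either one coordinate differing by 2, excluded by the all-ones
  check, or two coordinates differing by odd residues, on which all checks would then agree.\<close>

lemma parity_check_code_lee_distance:
  assumes i0: "i0 \<in> I" "\<And>x. x < \<beta> \<Longrightarrow> F i0 x = 1"
    and sep: "\<And>x y. x < \<beta> \<Longrightarrow> y < \<beta> \<Longrightarrow> (\<And>i. i \<in> I \<Longrightarrow> F i x mod 4 = F i y mod 4) \<Longrightarrow>
      (\<And>j. j \<in> J \<Longrightarrow> G j x mod 2 = G j y mod 2) \<Longrightarrow> x = y"
    and u: "u \<in> parity_check_code \<beta> I F J G" and v: "v \<in> parity_check_code \<beta> I F J G"
    and neq: "u \<noteq> v"
  shows "4 \<le> (\<Sum>x<\<beta>. lee_distance (u x) (v x))"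
proof -
  let ?L = "\<Sum>x<\<beta>. lee_distance (u x) (v x)"
  define S where "S = {x. x < \<beta> \<and> u x \<noteq> v x}"
  have finS: "finite S" by (simp add: S_def)
  have uG: "u \<in> {..<\<beta>} \<rightarrow>\<^sub>E {0..<4}" and vG: "v \<in> {..<\<beta>} \<rightarrow>\<^sub>E {0..<4}"
    using u v unfolding parity_check_code_def carrier_Z4_pow by blast+
  have ux: "u x \<in> {0..<4}" and vx: "v x \<in> {0..<4}" if "x < \<beta>" for x
    using PiE_mem[OF uG, of x] PiE_mem[OF vG, of x] that by auto
  have dot_diff: "dot \<beta> u f - dot \<beta> v f = (\<Sum>x\<in>S. (u x - v x) * f x)" for f
  proof -
    have "dot \<beta> u f - dot \<beta> v f = (\<Sum>x<\<beta>. (u x - v x) * f x)"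
      by (simp add: sum_subtractf left_diff_distrib)
    also have "\<dots> = (\<Sum>x\<in>S. (u x - v x) * f x)"
      by (rule sum.mono_neutral_right) (auto simp: S_def)
    finally show ?thesis .
  qed
  have check4: "4 dvd (\<Sum>x\<in>S. (u x - v x) * F i x)" if "i \<in> I" for i
    unfolding dot_diff[symmetric] using u v that
    by (intro dvd_diff) (auto simp: parity_check_code_def)
  have check2: "2 dvd (\<Sum>x\<in>S. (u x - v x) * G j x)" if "j \<in> J" for j
    unfolding dot_diff[symmetric] using u v that
    by (intro dvd_diff) (auto simp: parity_check_code_def)
  have check1: "4 dvd (\<Sum>x\<in>S. u x - v x)"
    using check4[OF i0(1)] i0(2) by (simp add: S_def)
  have LS: "?L = (\<Sum>x\<in>S. lee_distance (u x) (v x))"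
    by (rule sum.mono_neutral_right) (use ux vx in \<open>auto simp: S_def lee_distance_eq_0_iff\<close>)
  have pos: "1 \<le> lee_distance (u x) (v x)" if "x \<in> S" for x
    using that ux vx lee_distance_eq_0_iff[of "u x" "v x"] by (auto simp: S_def Suc_le_eq)
  \<comment> \<open>Distance and difference have the same parity in each coordinate, and the
    all-ones check makes the differences sum to 0 modulo 4. Below 4 this leaves only the distances 0
    and 2.\<close>
  have even_L: "even ?L"
  proof -
    have "even (\<Sum>x\<in>S. int (lee_distance (u x) (v x)) - (u x - v x))"
      by (intro dvd_sum) (use lee_distance_mod_2 ux vx in \<open>auto simp: S_def\<close>)
    moreover have "even (\<Sum>x\<in>S. u x - v x)"
      using check1 by (rule dvd_trans[rotated]) simp
    ultimately have "even (\<Sum>x\<in>S. int (lee_distance (u x) (v x)))"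
      by (simp add: sum_subtractf)
    then show ?thesis unfolding LS by (simp flip: of_nat_sum)
  qed
  have card_le: "card S \<le> ?L"
    unfolding LS using sum_mono[of S "\<lambda>_. 1" "\<lambda>x. lee_distance (u x) (v x)"] pos by simp
  have "S \<noteq> {}"
  proof
    assume "S = {}"
    then have "u = v"
      by (intro PiE_ext[OF uG vG]) (auto simp: S_def)
    with neq show False by simp
  qed
  then have "?L \<noteq> 0"
    using card_le finS by auto
  moreover have "?L \<noteq> 2"
  proof
    assume L2: "?L = 2"
    then have "card S = 1 \<or> card S = 2"
      using card_le finS \<open>S \<noteq> {}\<close> by (metis One_nat_def Suc_1 card_0_eq le_Suc_eq le_zero_eq)
    then show False
    proof
      assume "card S = 1"
      then obtain x where S: "S = {x}" by (auto simp: card_1_singleton_iff)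
      then have "x < \<beta>" by (auto simp: S_def)
      moreover have "lee_distance (u x) (v x) = 2"
        using L2 unfolding LS S by simp
      ultimately have "(u x - v x) mod 4 = 2"
        using lee_distance_eq_2 ux vx by blast
      then show False using check1 unfolding S by auto
    next
      assume "card S = 2"
      then obtain x y where S: "S = {x, y}" and xy: "x \<noteq> y" by (auto simp: card_2_iff)
      then have x: "x < \<beta>" and y: "y < \<beta>" by (auto simp: S_def)
      have "lee_distance (u x) (v x) + lee_distance (u y) (v y) = 2"
        using L2 xy unfolding LS S by simp
      then have "lee_distance (u x) (v x) = 1"
        using pos[of x] pos[of y] S by simp
      then have odd_a: "odd (u x - v x)"
        using lee_distance_mod_2[OF ux[OF x] vx[OF x]] by simp
      define a b where "a = u x - v x" and "b = u y - v y"
      have ab: "4 dvd a + b"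
        using check1 xy unfolding S by (simp add: a_def b_def)
      have odd_a: "odd a" using odd_a by (simp add: a_def)
      have "F i x mod 4 = F i y mod 4" if "i \<in> I" for i
      proof -
        have "4 dvd a * F i x + b * F i y"
          using check4[OF that] xy unfolding S by (simp add: a_def b_def)
        moreover have "4 dvd (a + b) * F i y"
          using ab by simp
        ultimately have "4 dvd (a * F i x + b * F i y) - (a + b) * F i y"
          by (rule dvd_diff)
        then have "4 dvd a * (F i x - F i y)"
          by (simp add: algebra_simps)
        moreover have "coprime (4::int) a"
          using odd_a by (metis coprime_commute coprime_left_2_iff_odd coprime_mult_left_iff mult_2 numeral_Bit0)
        ultimately show ?thesis
          by (simp add: coprime_dvd_mult_right_iff mod_eq_dvd_iff)
      qed
      moreover have "G j x mod 2 = G j y mod 2" if "j \<in> J" for j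
      proof -
        have "even (a * G j x + b * G j y)"
          using check2[OF that] xy unfolding S by (simp add: a_def b_def)
        moreover have "odd b"
          using ab odd_a by (metis dvd_trans even_add even_numeral)
        ultimately have "even (G j x) \<longleftrightarrow> even (G j y)"
          using odd_a by simp
        then show ?thesis
          by (simp add: mod_eq_dvd_iff)
      qed
      ultimately show False
        using sep[OF x y] xy by blast
    qed
  qed
  ultimately show ?thesis
    using even_L by presburger
qed

lemma quaternary_linear_perfect_code_parity_check:
  assumes fin: "finite I" "finite J" and indep: "independent_mod_2 (2 ^ (t - 1)) I F J G"
    and i0: "i0 \<in> I" "\<And>x. x < 2 ^ (t - 1) \<Longrightarrow> F i0 x = 1"
    and sep: "\<And>x y. x < 2 ^ (t - 1) \<Longrightarrow> y < 2 ^ (t - 1) \<Longrightarrow>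
      (\<And>i. i \<in> I \<Longrightarrow> F i x mod 4 = F i y mod 4) \<Longrightarrow>
      (\<And>j. j \<in> J \<Longrightarrow> G j x mod 2 = G j y mod 2) \<Longrightarrow> x = y"
    and card: "card J + 2 * card I = t + 1" and "card I < t"
  shows "quaternary_linear_perfect_code t (parity_check_code (2 ^ (t - 1)) I F J G)"
proof -
  define \<beta> :: nat where "\<beta> = 2 ^ (t - 1)"
  let ?C = "parity_check_code \<beta> I F J G"
  have "t > 0" using \<open>card I < t\<close> by simp
  have \<beta>2: "2 * \<beta> = 2 ^ t"
    using \<open>t > 0\<close> by (simp add: \<beta>_def flip: power_Suc)
  note indep = indep[folded \<beta>_def]
  have C: "quaternary_linear_code \<beta> ?C"
    using fin indep by (rule parity_check_code)
  have cardC: "card ?C = 2 ^ (2 ^ t - t - 1)"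
  proof -
    have "Suc t \<le> 2 ^ t"
      by (simp add: Suc_leI)
    then have "2 ^ t - t - 1 + (t + 1) = 2 ^ t"
      by simp
    then have "(2::nat) ^ (2 ^ t - t - 1) * 2 ^ (t + 1) = 2 ^ (2 ^ t)"
      by (metis power_add)
    also have "\<dots> = 4 ^ \<beta>"
      by (simp flip: \<beta>2 add: power_mult)
    also have "\<dots> = card ?C * 2 ^ (t + 1)"
      using parity_check_code(3)[OF fin indep] card by simp
    finally show ?thesis by simp
  qed
  have gray_sub: "gray_map \<beta> ` ?C \<subseteq> carrier (Z2_pow (2 ^ t))"
    unfolding \<beta>2[symmetric] by (auto simp: gray_map_def gray_digit_def carrier_integer_mod_group)
  have inj: "inj_on (gray_map \<beta>) ?C"
    using inj_on_gray_map by (rule inj_on_subset) (rule code_subset[OF C])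
  have "minimum_distance (2 ^ t) (gray_map \<beta> ` ?C) = 4"
    unfolding minimum_distance_def
  proof (rule Min_eqI)
    let ?A = "gray_map \<beta> ` ?C"
    have "{hamming_distance (2 ^ t) x y |x y. x \<in> ?A \<and> y \<in> ?A \<and> x \<noteq> y} \<subseteq>
        (\<lambda>(x, y). hamming_distance (2 ^ t) x y) ` (?A \<times> ?A)"
      by auto
    then show "finite {hamming_distance (2 ^ t) x y |x y. x \<in> ?A \<and> y \<in> ?A \<and> x \<noteq> y}"
      by (rule finite_subset) (use finite_code[OF C] in auto)
  next
    fix n assume "n \<in> {hamming_distance (2 ^ t) x y |x y.
      x \<in> gray_map \<beta> ` ?C \<and> y \<in> gray_map \<beta> ` ?C \<and> x \<noteq> y}"
    then obtain u v where "u \<in> ?C" "v \<in> ?C" "u \<noteq> v"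
      and n: "n = hamming_distance (2 * \<beta>) (gray_map \<beta> u) (gray_map \<beta> v)"
      unfolding \<beta>2 by auto
    then show "4 \<le> n"
      unfolding n hamming_distance_gray_map
      using parity_check_code_lee_distance[of i0 I \<beta> F J G u v] i0 sep unfolding \<beta>_def by blast
  next
    \<comment> \<open>A word at distance 4 from zero is found by pigeonhole. The all-ones check is
      odd everywhere, so only \<open>card I - 1\<close> parities matter; as
      \<open>card I < t\<close>, they form fewer than \<open>\<beta>\<close> patterns, and two
      coordinates share one.\<close>
    define par where "par x = {i \<in> I - {i0}. odd (F i x)}" for x
    have "card (par ` {..<\<beta>}) \<le> card (Pow (I - {i0}))"
      using fin by (intro card_mono) (auto simp: par_def)
    also have "\<dots> = 2 ^ (card I - 1)"
      using fin i0 by (simp add: card_Pow)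
    also have "\<dots> < \<beta>"
      unfolding \<beta>_def using \<open>card I < t\<close> i0 fin
      by (intro power_strict_increasing) (auto simp: card_gt_0_iff intro!: diff_less_mono Suc_leI)
    finally have "\<not> inj_on par {..<\<beta>}"
      by (intro pigeonhole) simp
    then obtain x y where xy: "x < \<beta>" "y < \<beta>" "x \<noteq> y" "par x = par y"
      by (auto simp: inj_on_def)
    have par: "even (F i x + F i y)" if "i \<in> I" for i
    proof (cases "i = i0")
      case True
      then show ?thesis using i0 xy by (simp add: \<beta>_def)
    next
      case False
      then have "i \<in> par x \<longleftrightarrow> i \<in> par y" using xy by simp
      then show ?thesis using False that by (simp add: par_def)
    qed
    \<comment> \<open>The entries 2 double every check value, so agreement of parities at
      \<open>x\<close> and \<open>y\<close> suffices modulo 4, and each entry has Lee weight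
      2.\<close>
    define w :: "nat \<Rightarrow> int" where "w = (\<lambda>z\<in>{..<\<beta>}. 2 * of_bool (z \<in> {x, y}))"
    have dot_w: "dot \<beta> w f = 2 * (f x + f y)" for f
    proof -
      have "dot \<beta> w f = (\<Sum>z\<in>{x, y}. 2 * f z)"
        using xy by (intro sum.mono_neutral_cong_right) (auto simp: w_def)
      then show ?thesis using xy by simp
    qed
    have "w \<in> ?C"
      unfolding parity_check_code_def
    proof (intro CollectI conjI ballI)
      show "w \<in> carrier (Z4_pow \<beta>)"
        unfolding carrier_Z4_pow by (auto simp: w_def)
      show "dot \<beta> w (F i) mod 4 = 0" if "i \<in> I" for i
        unfolding dot_w using mult_dvd_mono[OF dvd_refl[of 2] par[OF that]] by simp
      show "dot \<beta> w (G j) mod 2 = 0" for j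
        unfolding dot_w by simp
    qed
    moreover have zero: "(\<lambda>z\<in>{..<\<beta>}. 0) \<in> ?C"
      using C by (rule zero_in_code)
    moreover have "w \<noteq> (\<lambda>z\<in>{..<\<beta>}. 0)"
      using xy by (auto simp: w_def fun_eq_iff restrict_def)
    moreover have "hamming_distance (2 * \<beta>) (gray_map \<beta> w) (gray_map \<beta> (\<lambda>z\<in>{..<\<beta>}. 0)) = 4"
    proof -
      have "(\<Sum>z<\<beta>. lee_distance (w z) ((\<lambda>z\<in>{..<\<beta>}. 0) z)) = (\<Sum>z\<in>{x, y}. 2)"
        using xy by (intro sum.mono_neutral_cong_right)
          (auto simp: w_def lee_distance_def gray_digit_def)
      then show ?thesis
        using xy unfolding hamming_distance_gray_map by simp
    qed
    ultimately show "4 \<in> {hamming_distance (2 ^ t) x y |x y.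
        x \<in> gray_map \<beta> ` ?C \<and> y \<in> gray_map \<beta> ` ?C \<and> x \<noteq> y}"
      unfolding \<beta>2[symmetric] using inj_onD[OF inj] by (smt (verit) image_eqI mem_Collect_eq)
  qed
  moreover have "all_ones \<beta> \<in> dual_code \<beta> ?C"
  proof -
    have "all_ones \<beta> \<in> carrier (Z4_pow \<beta>)"
      unfolding carrier_Z4_pow by (auto simp: all_ones_def)
    moreover have "dot \<beta> (all_ones \<beta>) v mod 4 = 0" if "v \<in> ?C" for v
    proof -
      have "dot \<beta> (all_ones \<beta>) v = dot \<beta> v (F i0)"
        using i0(2) by (intro sum.cong) (auto simp: all_ones_def \<beta>_def)
      then show ?thesis
        using that i0(1) by (simp add: parity_check_code_def)
    qed
    ultimately show ?thesis by (simp add: dual_code_def)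
  qed
  ultimately show ?thesis
    unfolding quaternary_linear_perfect_code_def extended_perfect_parameters_def \<beta>_def[symmetric]
    using C gray_sub cardC card_image[OF inj] by simp
qed

subsection \<open>Coordinates as subsets and a nonlinear relabelling\<close>

definition abit :: "nat \<Rightarrow> nat set \<Rightarrow> int" where
  "abit k A = of_bool (k \<in> A)"

definition next_bit :: "nat \<Rightarrow> nat \<Rightarrow> nat" where
  "next_bit m k = (if Suc k = m then 0 else Suc k)"

text \<open>The two ends of a cube edge in direction \<open>k\<close>. Edges at the empty set would
  all share that point; starting instead at the cyclic successor of \<open>k\<close> separates the
  edges of different directions.\<close>

definition moved :: "nat \<Rightarrow> nat \<Rightarrow> nat set \<Rightarrow> bool" where
  "moved m k A \<longleftrightarrow> A = {next_bit m k} \<or> A = {k, next_bit m k}"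

text \<open>The product of the disjoint transpositions exchanging \<open>{next_bit m k}\<close> and
  \<open>{k, next_bit m k}\<close> for \<open>k \<in> K\<close>.\<close>

definition relabel :: "nat \<Rightarrow> nat set \<Rightarrow> nat set \<Rightarrow> nat set" where
  "relabel m K A = {k. k < m \<and> (k \<in> A) \<noteq> (k \<in> K \<and> moved m k A)}"

text \<open>Singletons are told apart because \<open>next_bit m\<close> is injective; two-element
  sets could coincide for different bits only along a 2-cycle of \<open>next_bit m\<close>, which
  \<open>3 \<le> m\<close> excludes.\<close>

lemma moved_unique:
  assumes "3 \<le> m" "k < m" "l < m" "moved m k A" "moved m l A"
  shows "k = l"
proof -
  have "next_bit m k \<noteq> k" "next_bit m l \<noteq> l" "next_bit m (next_bit m k) \<noteq> k"
    using assms(1-3) by (simp_all add: next_bit_def)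
  moreover have "next_bit m k = next_bit m l \<Longrightarrow> k = l"
    using assms(1-3) by (simp add: next_bit_def split: if_splits)
  ultimately show ?thesis
    using assms(4,5) unfolding moved_def by (auto simp: doubleton_eq_iff)
qed

lemma relabel_eq:
  assumes "3 \<le> m" "K \<subseteq> {..<m}" "A \<subseteq> {..<m}" "k \<in> K" "moved m k A"
  shows "relabel m K A = (if A = {next_bit m k} then {k, next_bit m k} else {next_bit m k})"
proof -
  have k: "k < m" using assms by auto
  have "(l \<in> K \<and> moved m l A) \<longleftrightarrow> l = k" for l
    using assms moved_unique[of m l k A] k by auto
  then have rel: "relabel m K A = {l. l < m \<and> (l \<in> A) \<noteq> (l = k)}"
    by (simp add: relabel_def)
  define n where "n = next_bit m k"
  have n: "n \<noteq> k" "n < m"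
    using k assms(1) by (auto simp: n_def next_bit_def)
  from assms(5) have "A = {n} \<or> A = {k, n}"
    by (simp add: moved_def n_def)
  then show ?thesis
    unfolding n_def[symmetric] rel
  proof
    assume A: "A = {n}"
    show "{l. l < m \<and> (l \<in> A) \<noteq> (l = k)} = (if A = {n} then {k, n} else {n})"
      unfolding A using n k by auto
  next
    assume A: "A = {k, n}"
    have "{k, n} \<noteq> {n}" using n by auto
    moreover have "{l. l < m \<and> (l \<in> A) \<noteq> (l = k)} = {n}"
      unfolding A using n k by auto
    ultimately show "{l. l < m \<and> (l \<in> A) \<noteq> (l = k)} = (if A = {n} then {k, n} else {n})"
      unfolding A by (simp only: if_False)
  qed
qed

text \<open>Each transposition stays inside its own pair and the pairs are disjoint, so no point
  enters or leaves a pair. This is what makes \<open>relabel\<close> an involution.\<close>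

lemma moved_relabel_iff:
  assumes "3 \<le> m" "K \<subseteq> {..<m}" "A \<subseteq> {..<m}" "k \<in> K"
  shows "moved m k (relabel m K A) \<longleftrightarrow> moved m k A"
proof
  assume "moved m k A"
  then show "moved m k (relabel m K A)"
    using relabel_eq[OF assms] by (auto simp: moved_def)
next
  assume *: "moved m k (relabel m K A)"
  show "moved m k A"
  proof (cases "\<exists>l\<in>K. moved m l A")
    case True
    then obtain l where l: "l \<in> K" "moved m l A" by blast
    then have "moved m l (relabel m K A)"
      using relabel_eq[OF assms(1-3)] by (auto simp: moved_def)
    then have "l = k"
      using moved_unique[OF assms(1) _ _ _ *] assms l by auto
    then show ?thesis using l by simp
  next
    case False
    then have "relabel m K A = A"
      using assms(3) by (auto simp: relabel_def)
    then show ?thesis using * by simp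
  qed
qed

lemma bij_betw_relabel:
  assumes "3 \<le> m" "K \<subseteq> {..<m}"
  shows "bij_betw (relabel m K) (Pow {..<m}) (Pow {..<m})"
proof (rule bij_betw_byWitness[where f' = "relabel m K"])
  have "relabel m K (relabel m K A) = A" if "A \<subseteq> {..<m}" for A
  proof -
    have "k \<in> relabel m K (relabel m K A) \<longleftrightarrow> k \<in> A" for k
    proof (cases "k < m")
      case True
      then show ?thesis
        using moved_relabel_iff[OF assms that, of k]
        by (cases "k \<in> K"; cases "k \<in> A"; cases "moved m k A") (simp_all add: relabel_def)
    qed (use that in \<open>auto simp: relabel_def\<close>)
    then show ?thesis by blast
  qed
  then show "\<forall>A\<in>Pow {..<m}. relabel m K (relabel m K A) = A"
    "\<forall>A\<in>Pow {..<m}. relabel m K (relabel m K A) = A"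
    by auto
qed (auto simp: relabel_def)

text \<open>Exclusive or, written as \<open>x + y - 2 * (x * y)\<close>. The product term vanishes
  modulo 2, and modulo 4 as soon as the bit carries the weight 2 of a high bit.\<close>

lemma abit_relabel:
  assumes "k < m"
  shows "abit k (relabel m K A) =
    (if k \<in> K then abit k A + of_bool (moved m k A) - 2 * (abit k A * of_bool (moved m k A))
     else abit k A)"
  using assms by (auto simp: abit_def relabel_def)

text \<open>Subsets pair off by adding or removing \<open>l\<close>, and \<open>f\<close> takes
  equal values on each pair.\<close>

lemma even_sum_Pow_if_indifferent:
  fixes f :: "nat set \<Rightarrow> int"
  assumes "l < m" "\<And>A. f (insert l A) = f A"
  shows "even (\<Sum>A\<in>Pow {..<m}. f A)"
proof -
  let ?P = "Pow ({..<m} - {l})"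
  have "{..<m} = insert l ({..<m} - {l})"
    using assms(1) by auto
  then have "Pow {..<m} = ?P \<union> insert l ` ?P"
    by (metis Pow_insert)
  moreover have "?P \<inter> insert l ` ?P = {}"
    by auto
  moreover have "inj_on (insert l) ?P"
    by (auto simp: inj_on_def)
  ultimately have "(\<Sum>A\<in>Pow {..<m}. f A) = (\<Sum>A\<in>?P. f A) + (\<Sum>A\<in>?P. f A)"
    by (simp add: sum.union_disjoint sum.reindex assms(2))
  then show ?thesis by simp
qed

text \<open>Summing over all subsets weighted by one bit kills the affine functions, because a product
  of two bits ignores some third bit, and it isolates the coefficient of one
  indicator \<^const>\<open>moved\<close>.\<close>

lemma bits_and_moved_independent:
  assumes m: "3 \<le> m" and K: "K \<subseteq> {..<m}"
    and even: "\<And>A. A \<subseteq> {..<m} \<Longrightarrow>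
      even (a0 + (\<Sum>k<m. a k * abit k A) + (\<Sum>k\<in>K. c k * of_bool (moved m k A)))"
  shows "even a0" "\<And>k. k < m \<Longrightarrow> even (a k)" "\<And>k. k \<in> K \<Longrightarrow> even (c k)"
proof -
  have finK: "finite K" using K finite_subset by blast
  have ignore: "even (\<Sum>A\<in>Pow {..<m}. abit i A * abit k A)" if "i < m" "k < m" for i k
  proof -
    have "\<exists>l\<in>{0, 1, 2::nat}. l \<noteq> i \<and> l \<noteq> k" by auto
    then obtain l where "l \<in> {0, 1, 2}" "l \<noteq> i" "l \<noteq> k" by blast
    moreover from this have "l < m" using m by auto
    ultimately show ?thesis
      by (intro even_sum_Pow_if_indifferent[of l]) (auto simp: abit_def)
  qed
  have c: "even (c i)" if i: "i \<in> K" for i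
  proof -
    have im: "i < m" using i K by auto
    have "even (\<Sum>A\<in>Pow {..<m}. abit i A *
        (a0 + (\<Sum>k<m. a k * abit k A) + (\<Sum>k\<in>K. c k * of_bool (moved m k A))))"
      using even by (intro dvd_sum dvd_mult) auto
    also have "(\<Sum>A\<in>Pow {..<m}. abit i A *
        (a0 + (\<Sum>k<m. a k * abit k A) + (\<Sum>k\<in>K. c k * of_bool (moved m k A)))) =
        a0 * (\<Sum>A\<in>Pow {..<m}. abit i A * abit i A) +
        (\<Sum>k<m. a k * (\<Sum>A\<in>Pow {..<m}. abit i A * abit k A)) +
        (\<Sum>k\<in>K. c k * (\<Sum>A\<in>Pow {..<m}. abit i A * of_bool (moved m k A)))"
    proof -
      have "abit i A * (a0 + (\<Sum>k<m. a k * abit k A) + (\<Sum>k\<in>K. c k * of_bool (moved m k A))) =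
          a0 * (abit i A * abit i A) + (\<Sum>k<m. a k * (abit i A * abit k A)) +
          (\<Sum>k\<in>K. c k * (abit i A * of_bool (moved m k A)))" for A
      proof -
        \<comment> \<open>A bit equals its square, so the constant term is covered by
          \<open>ignore\<close> like the products of two bits.\<close>
        have "abit i A * a0 = a0 * (abit i A * abit i A)"
          by (simp add: abit_def)
        then show ?thesis
          by (simp only: distrib_left sum_distrib_left mult.left_commute[of "abit i A"])
      qed
      then show ?thesis
        by (simp only: sum.distrib sum_distrib_left sum.swap[of _ _ "Pow {..<m}"])
    qed
    finally have "even (a0 * (\<Sum>A\<in>Pow {..<m}. abit i A * abit i A) +
        (\<Sum>k<m. a k * (\<Sum>A\<in>Pow {..<m}. abit i A * abit k A)) +
        (\<Sum>k\<in>K. c k * (\<Sum>A\<in>Pow {..<m}. abit i A * of_bool (moved m k A))))" .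
    moreover have "even (a0 * (\<Sum>A\<in>Pow {..<m}. abit i A * abit i A))"
      using ignore[OF im im] by simp
    moreover have "even (\<Sum>k<m. a k * (\<Sum>A\<in>Pow {..<m}. abit i A * abit k A))"
      using ignore[OF im] by (intro dvd_sum, intro dvd_mult) auto
    ultimately have "even (\<Sum>k\<in>K. c k * (\<Sum>A\<in>Pow {..<m}. abit i A * of_bool (moved m k A)))"
      by simp
    \<comment> \<open>Both moved points contain \<open>next_bit m k\<close>, but only one contains
      \<open>k\<close>; modulo 2 the weight \<open>abit i\<close> therefore sees the indicator of
      direction \<open>i\<close> alone.\<close>
    moreover have "(\<Sum>A\<in>Pow {..<m}. abit i A * of_bool (moved m k A)) =
        2 * of_bool (i = next_bit m k) + of_bool (i = k)" if "k \<in> K" for k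
    proof -
      have k: "k < m" "next_bit m k < m" "next_bit m k \<noteq> k"
        using that K m by (auto simp: next_bit_def)
      then have ne: "{next_bit m k} \<noteq> {k, next_bit m k}" by auto
      have "(\<Sum>A\<in>Pow {..<m}. abit i A * of_bool (moved m k A)) =
          (\<Sum>A\<in>{{next_bit m k}, {k, next_bit m k}}. abit i A)"
        using k by (intro sum.mono_neutral_cong_right) (auto simp: moved_def)
      also have "\<dots> = abit i {next_bit m k} + abit i {k, next_bit m k}"
        using ne by simp
      also have "\<dots> = 2 * of_bool (i = next_bit m k) + of_bool (i = k)"
        using k(3) by (auto simp: abit_def)
      finally show ?thesis .
    qed
    ultimately have "even (\<Sum>k\<in>K. c k * (2 * of_bool (i = next_bit m k) + of_bool (i = k)))"
      by simp
    also have "(\<Sum>k\<in>K. c k * (2 * of_bool (i = next_bit m k) + of_bool (i = k))) =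
        2 * (\<Sum>k\<in>K. c k * of_bool (i = next_bit m k)) + (\<Sum>k\<in>K. c k * of_bool (i = k))"
      by (simp add: distrib_left sum.distrib sum_distrib_left mult_ac)
    also have "(\<Sum>k\<in>K. c k * of_bool (i = k)) = c i"
      using i finK by (simp add: of_bool_def if_distrib cong: if_cong)
    finally show ?thesis by simp
  qed
  then show "\<And>k. k \<in> K \<Longrightarrow> even (c k)" .
  have sum_c: "even (\<Sum>k\<in>K. c k * of_bool (moved m k A))" for A
    using c by (intro dvd_sum dvd_mult2)
  have affine: "even (a0 + (\<Sum>k<m. a k * abit k A))" if "A \<subseteq> {..<m}" for A
    using even[OF that] sum_c[of A] by simp
  show a0: "even a0"
    using affine[of "{}"] by (simp add: abit_def)
  show "even (a k)" if "k < m" for k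
  proof -
    have "(\<Sum>l<m. a l * abit l {k}) = a k"
      using that by (simp add: abit_def of_bool_def if_distrib cong: if_cong)
    then show ?thesis using affine[of "{k}"] a0 that by simp
  qed
qed

subsection \<open>Duals of quaternary Hadamard codes\<close>

text \<open>The point map \<open>P\<close> identifies the coordinates with subsets of \<open>{..<m}\<close>; the index \<open>m\<close>
  stands for the all-ones check and \<open>k < m\<close> for the quaternary digit with low bit \<open>k\<close> and
  high bit \<open>h k\<close>.\<close>

definition digit_check :: "nat \<Rightarrow> (nat \<Rightarrow> nat) \<Rightarrow> (nat \<Rightarrow> nat set) \<Rightarrow> nat \<Rightarrow> nat \<Rightarrow> int" where
  "digit_check m h P k x = (if k = m then 1 else abit k (P x) + 2 * abit (h k) (P x))"

definition hadamard_dual ::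
    "nat \<Rightarrow> (nat \<Rightarrow> nat) \<Rightarrow> (nat \<Rightarrow> nat set) \<Rightarrow> nat set \<Rightarrow> (nat \<Rightarrow> int) set" where
  "hadamard_dual m h P L = parity_check_code (2 ^ m) (insert m L) (digit_check m h P)
     ({..<m} - L - h ` L) (\<lambda>k x. abit k (P x))"

text \<open>Modulo 2 a digit is its low bit, so a quaternary check implies the binary check of its
  low bit.\<close>

lemma even_dot_abit:
  assumes "k \<noteq> m" "4 dvd dot n u (digit_check m h P k)"
  shows "even (dot n u (\<lambda>x. abit k (P x)))"
proof -
  have "dot n u (digit_check m h P k) =
      dot n u (\<lambda>x. abit k (P x)) + 2 * dot n u (\<lambda>x. abit (h k) (P x))"
    using assms(1) by (simp add: digit_check_def distrib_left sum.distrib sum_distrib_left mult_ac)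
  moreover have "even (dot n u (digit_check m h P k))"
    using assms(2) by (rule dvd_trans[rotated]) simp
  ultimately show ?thesis by simp
qed

lemma even_sum_cong:
  fixes f g :: "'a \<Rightarrow> int"
  assumes "\<And>i. i \<in> I \<Longrightarrow> even (f i) = even (g i)"
  shows "even (sum f I) = even (sum g I)"
proof -
  have "even (\<Sum>i\<in>I. f i - g i)"
    using assms by (intro dvd_sum) simp
  then show ?thesis by (simp add: sum_subtractf)
qed

locale hadamard_parameters =
  fixes m :: nat and h :: "nat \<Rightarrow> nat" and P :: "nat \<Rightarrow> nat set" and L :: "nat set"
  assumes m: "0 < m" and P: "bij_betw P {..<2 ^ m} (Pow {..<m})"
    and L: "L \<subseteq> {..<m}" and h: "inj_on h L" "h ` L \<subseteq> {..<m}" "L \<inter> h ` L = {}"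
begin

lemma finL: "finite L"
  using L finite_subset by blast

lemma card_bits: "card ({..<m} - L - h ` L) + 2 * card L = m"
proof -
  have "card ({..<m} - L - h ` L) = card ({..<m} - (L \<union> h ` L))"
    by (simp add: set_diff_eq conj_ac)
  also have "\<dots> = m - card (L \<union> h ` L)"
    using L h finL by (subst card_Diff_subset) auto
  also have "card (L \<union> h ` L) = 2 * card L"
    using h finL by (simp add: card_Un_disjoint card_image)
  moreover have "card (L \<union> h ` L) \<le> card {..<m}"
    using L h by (intro card_mono) auto
  ultimately show ?thesis using \<open>card (L \<union> h ` L) = 2 * card L\<close> by simp
qed

lemma ex_point:
  assumes "A \<subseteq> {..<m}"
  obtains x where "x < 2 ^ m" "P x = A"
proof -
  have "A \<in> P ` {..<2 ^ m}"
    using bij_betw_imp_surj_on[OF P] assms by simp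
  then show ?thesis using that by auto
qed

text \<open>Modulo 2 the checks are the constant 1 and distinct bits; the empty set and the
  singletons tell them apart.\<close>

lemma independent_checks:
  "independent_mod_2 (2 ^ m) (insert m L) (digit_check m h P)
     ({..<m} - L - h ` L) (\<lambda>k x. abit k (P x))"
  unfolding independent_mod_2_def
proof (intro allI impI)
  fix a c :: "nat \<Rightarrow> int"
  let ?J = "{..<m} - L - h ` L"
  assume *: "\<forall>x<2 ^ m. even ((\<Sum>i\<in>insert m L. a i * digit_check m h P i x) +
    (\<Sum>j\<in>?J. c j * abit j (P x)))"
  have mL: "m \<notin> L" using L by auto
  have ev: "even (a m + (\<Sum>i\<in>L. a i * abit i A) + (\<Sum>j\<in>?J. c j * abit j A))"
    if "A \<subseteq> {..<m}" for A
  proof -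
    obtain x where x: "x < 2 ^ m" "P x = A" using ex_point[OF \<open>A \<subseteq> {..<m}\<close>] .
    have "even (\<Sum>i\<in>L. a i * digit_check m h P i x) = even (\<Sum>i\<in>L. a i * abit i A)"
      using mL x by (intro even_sum_cong) (auto simp: digit_check_def)
    moreover have "(\<Sum>i\<in>insert m L. a i * digit_check m h P i x) =
        a m + (\<Sum>i\<in>L. a i * digit_check m h P i x)"
      using mL finL by (simp add: digit_check_def)
    moreover have "even ((\<Sum>i\<in>insert m L. a i * digit_check m h P i x) +
        (\<Sum>j\<in>?J. c j * abit j A))"
      using *[rule_format, OF x(1)] x(2) by simp
    ultimately show ?thesis by simp
  qed
  have am: "even (a m)"
    using ev[of "{}"] by (simp add: abit_def)
  have "even (a k)" if "k \<in> L" for k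
  proof -
    have "(\<Sum>i\<in>L. a i * abit i {k}) = a k"
      using that finL by (simp add: abit_def of_bool_def if_distrib cong: if_cong)
    moreover have "(\<Sum>j\<in>?J. c j * abit j {k}) = 0"
      using that by (intro sum.neutral) (auto simp: abit_def)
    ultimately show ?thesis using ev[of "{k}"] am that L by auto
  qed
  moreover have "even (c k)" if "k \<in> ?J" for k
  proof -
    have "(\<Sum>j\<in>?J. c j * abit j {k}) = (\<Sum>j\<in>?J. if j = k then c k else 0)"
      by (intro sum.cong) (auto simp: abit_def)
    then have "(\<Sum>j\<in>?J. c j * abit j {k}) = c k"
      using that by simp
    moreover have "(\<Sum>i\<in>L. a i * abit i {k}) = 0"
      using that by (intro sum.neutral) (auto simp: abit_def)
    ultimately show ?thesis using ev[of "{k}"] am that by auto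
  qed
  ultimately show "(\<forall>i\<in>insert m L. even (a i)) \<and> (\<forall>j\<in>?J. even (c j))"
    using am by blast
qed

lemma of_dual_type_hadamard_dual:
  "of_dual_type (2 ^ m) (hadamard_dual m h P L) (m - 2 * card L) (card L + 1)"
proof -
  have "card (insert m L) = card L + 1"
    using finL L by (subst card_insert_disjoint) auto
  moreover have "card ({..<m} - L - h ` L) = m - 2 * card L"
    using card_bits by simp
  ultimately show ?thesis
    unfolding hadamard_dual_def
    using parity_check_code(2)[OF _ _ independent_checks] finL by (metis finite_Diff finite_insert finite_lessThan)
qed

lemma quaternary_linear_perfect_code_hadamard_dual:
  "quaternary_linear_perfect_code (m + 1) (hadamard_dual m h P L)"
proof -
  have cL: "card (insert m L) = card L + 1"
    using finL L by (subst card_insert_disjoint) auto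
  \<comment> \<open>A digit modulo 4 reveals both of its bits, so the checks together recover the
    whole point.\<close>
  have sep: "x = y"
    if xy: "x < 2 ^ m" "y < 2 ^ m"
      and F: "\<And>i. i \<in> insert m L \<Longrightarrow> digit_check m h P i x mod 4 = digit_check m h P i y mod 4"
      and G: "\<And>j. j \<in> {..<m} - L - h ` L \<Longrightarrow> abit j (P x) mod 2 = abit j (P y) mod 2" for x y
  proof -
    have digit: "l \<in> P x \<longleftrightarrow> l \<in> P y" "h l \<in> P x \<longleftrightarrow> h l \<in> P y" if "l \<in> L" for l
    proof -
      have "l \<noteq> m" using that L by auto
      then have "(abit l (P x) + 2 * abit (h l) (P x)) mod 4 =
          (abit l (P y) + 2 * abit (h l) (P y)) mod 4"
        using F[of l] that by (simp add: digit_check_def)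
      then show "l \<in> P x \<longleftrightarrow> l \<in> P y" "h l \<in> P x \<longleftrightarrow> h l \<in> P y"
        by (auto simp: abit_def of_bool_def split: if_splits)
    qed
    have "k \<in> P x \<longleftrightarrow> k \<in> P y" if "k < m" for k
    proof (cases "k \<in> L \<union> h ` L")
      case True
      then show ?thesis using digit by auto
    next
      case False
      then show ?thesis using G[of k] that by (auto simp: abit_def of_bool_def split: if_splits)
    qed
    moreover have "P x \<subseteq> {..<m}" "P y \<subseteq> {..<m}"
      using bij_betwE[OF P] xy by auto
    ultimately have "P x = P y" by blast
    then show ?thesis
      using bij_betw_imp_inj_on[OF P] xy by (auto dest: inj_onD)
  qed
  have "quaternary_linear_perfect_code (m + 1) (parity_check_code (2 ^ (m + 1 - 1))
      (insert m L) (digit_check m h P) ({..<m} - L - h ` L) (\<lambda>k x. abit k (P x)))"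
  proof (rule quaternary_linear_perfect_code_parity_check[where ?i0.0 = m], unfold add_diff_cancel_right')
    show "card ({..<m} - L - h ` L) + 2 * card (insert m L) = m + 1 + 1"
      using card_bits by (simp add: cL)
    show "card (insert m L) < m + 1"
      using card_bits m by (simp add: cL)
    show "independent_mod_2 (2 ^ m) (insert m L) (digit_check m h P)
        ({..<m} - L - h ` L) (\<lambda>k x. abit k (P x))"
      by (rule independent_checks)
    show "x = y" if "x < 2 ^ m" "y < 2 ^ m"
      "\<And>i. i \<in> insert m L \<Longrightarrow> digit_check m h P i x mod 4 = digit_check m h P i y mod 4"
      "\<And>j. j \<in> {..<m} - L - h ` L \<Longrightarrow> abit j (P x) mod 2 = abit j (P y) mod 2" for x y
      using that by (rule sep)
  qed (use finL in \<open>simp_all add: digit_check_def\<close>)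
  then show ?thesis
    by (simp add: hadamard_dual_def)
qed

text \<open>Adding the implied binary checks of the low bits lets the parity condition run over all
  bits that are not high. In this form two codes with different low bits can be compared bit by
  bit.\<close>

lemma hadamard_dual_iff:
  "u \<in> hadamard_dual m h P L \<longleftrightarrow> u \<in> carrier (Z4_pow (2 ^ m)) \<and>
     (\<forall>k\<in>insert m L. 4 dvd dot (2 ^ m) u (digit_check m h P k)) \<and>
     (\<forall>k<m. k \<notin> h ` L \<longrightarrow> even (dot (2 ^ m) u (\<lambda>x. abit k (P x))))"
proof -
  have "m \<notin> L" using L by auto
  then have "even (dot (2 ^ m) u (\<lambda>x. abit k (P x)))"
    if "k \<in> L" "4 dvd dot (2 ^ m) u (digit_check m h P k)" for k
    using even_dot_abit that by metis
  then show ?thesis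
    unfolding hadamard_dual_def parity_check_code_def
    by (auto simp: mod_eq_0_iff_dvd even_iff_mod_2_eq_zero[symmetric])
qed

end

subsection \<open>Intersections\<close>

text \<open>Two Hadamard duals on the bits \<open>{..<m}\<close>: the first uses low bits \<open>A \<union> B\<^sub>1\<close> and high bits
  \<open>S \<union> T\<^sub>1\<close>, the second low bits \<open>A \<union> B\<^sub>2\<close> and high bits \<open>S \<union> T\<^sub>2\<close>, read off after relabelling
  the points along \<open>K\<close>.\<close>

locale hadamard_pair =
  fixes m :: nat and h :: "nat \<Rightarrow> nat" and P :: "nat \<Rightarrow> nat set"
    and A B\<^sub>1 B\<^sub>2 S T\<^sub>1 T\<^sub>2 K :: "nat set"
  assumes m: "3 \<le> m" and P: "bij_betw P {..<2 ^ m} (Pow {..<m})"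
    and bits: "A \<union> B\<^sub>1 \<union> B\<^sub>2 \<subseteq> {..<m}" "S \<subseteq> {..<m}" "T\<^sub>1 \<subseteq> {..<m}" "T\<^sub>2 \<subseteq> {..<m}" "K \<subseteq> {..<m}"
    and low: "A \<inter> B\<^sub>1 = {}" "A \<inter> B\<^sub>2 = {}" "B\<^sub>1 \<inter> B\<^sub>2 = {}"
    and high: "h ` (A \<union> B\<^sub>1) = S \<union> T\<^sub>1" "h ` (A \<union> B\<^sub>2) = S \<union> T\<^sub>2"
      "inj_on h (A \<union> B\<^sub>1)" "inj_on h (A \<union> B\<^sub>2)"
    and disj: "S \<inter> (A \<union> B\<^sub>1 \<union> B\<^sub>2) = {}" "T\<^sub>1 \<inter> (A \<union> B\<^sub>1) = {}" "T\<^sub>2 \<inter> (A \<union> B\<^sub>2) = {}" "T\<^sub>1 \<inter> T\<^sub>2 = {}"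
    and K: "K \<inter> A = {}" "K \<inter> T\<^sub>1 = {}" "K \<inter> T\<^sub>2 = {}" "K \<inter> S \<subseteq> h ` A"
begin

definition P' :: "nat \<Rightarrow> nat set" where
  "P' x = relabel m K (P x)"

text \<open>Digits with low bit in \<open>B\<^sub>2\<close> occur only in the second code and are
  read through \<open>P'\<close>. A digit with low bit in \<open>A\<close> occurs in both; its two
  readings differ by at most twice a moved-point indicator modulo 4, which gets its own binary
  check.\<close>

definition pair_check :: "nat \<Rightarrow> nat \<Rightarrow> int" where
  "pair_check k = digit_check m h (if k \<in> B\<^sub>2 then P' else P) k"

definition pair_even_check :: "nat + nat \<Rightarrow> nat \<Rightarrow> int" where
  "pair_even_check = case_sum (\<lambda>k x. abit k (P x)) (\<lambda>k x. of_bool (moved m k (P x)))"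

abbreviation "E \<equiv> A \<union> B\<^sub>1 \<union> B\<^sub>2"

sublocale first: hadamard_parameters m h P "A \<union> B\<^sub>1"
  using m P bits low high disj by unfold_locales auto

sublocale second: hadamard_parameters m h P' "A \<union> B\<^sub>2"
proof
  show "bij_betw P' {..<2 ^ m} (Pow {..<m})"
    using bij_betw_trans[OF P bij_betw_relabel[OF m bits(5)]]
    by (simp add: P'_def[abs_def] comp_def)
qed (use m bits low high disj in auto)

lemma abit_P':
  "k < m \<Longrightarrow> abit k (P' x) = (if k \<in> K
     then abit k (P x) + of_bool (moved m k (P x)) - 2 * (abit k (P x) * of_bool (moved m k (P x)))
     else abit k (P x))"
  unfolding P'_def by (rule abit_relabel)

lemma dot_abit_P':
  assumes "k \<in> K"
  shows "even (dot n u (\<lambda>x. abit k (P' x))) \<longleftrightarrow>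
    (even (dot n u (\<lambda>x. abit k (P x))) \<longleftrightarrow> even (dot n u (\<lambda>x. of_bool (moved m k (P x)))))"
proof -
  have "k < m" using assms bits by auto
  then have "dot n u (\<lambda>x. abit k (P' x)) =
      dot n u (\<lambda>x. abit k (P x)) + dot n u (\<lambda>x. of_bool (moved m k (P x)))
        - 2 * dot n u (\<lambda>x. abit k (P x) * of_bool (moved m k (P x)))"
    unfolding abit_P'[OF \<open>k < m\<close>] using assms
    by (simp only: if_True distrib_left right_diff_distrib sum.distrib sum_subtractf
        sum_distrib_left mult.left_commute[of _ 2])
  then show ?thesis by simp
qed

text \<open>As \<open>K\<close> avoids \<open>A\<close>, only the high bit can change, and modulo 4
  this adds twice the indicator. Checking one digit through both point maps thus isolates the
  indicator modulo 2.\<close>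

lemma dot_digit_check_P':
  assumes "l \<in> A" "4 dvd dot n u (digit_check m h P l)"
  shows "4 dvd dot n u (digit_check m h P' l) \<longleftrightarrow>
    (h l \<in> K \<longrightarrow> even (dot n u (\<lambda>x. of_bool (moved m (h l) (P x)))))"
proof -
  have l: "l < m" "l \<notin> K" "h l < m"
    using assms bits K(1) first.h(2) by auto
  show ?thesis
  proof (cases "h l \<in> K")
    case False
    then have "digit_check m h P' l = digit_check m h P l"
      using l by (simp add: fun_eq_iff digit_check_def abit_P')
    then show ?thesis using assms False by simp
  next
    case True
    let ?N = "\<lambda>x. of_bool (moved m (h l) (P x)) :: int"
    have "digit_check m h P' l x =
        digit_check m h P l x + 2 * ?N x - 4 * (abit (h l) (P x) * ?N x)" for x
      using l True by (simp add: digit_check_def abit_P' algebra_simps)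
    then have "dot n u (digit_check m h P' l) = dot n u (digit_check m h P l) + 2 * dot n u ?N
        - 4 * dot n u (\<lambda>x. abit (h l) (P x) * ?N x)"
      by (simp only: distrib_left right_diff_distrib sum.distrib sum_subtractf
        sum_distrib_left mult.left_commute[of _ 2] mult.left_commute[of _ 4])
    then show ?thesis
      using assms(2) True by (simp only:) presburger
  qed
qed

text \<open>A bit that is high in only one code is still checked modulo 2 by the other, so only the
  bits of \<open>S\<close> have no parity check. For \<open>k\<close> in \<open>K\<close> outside
  \<open>S\<close>, both codes check bit \<open>k\<close> modulo 2, one before and one after
  relabelling, and the difference is the indicator. For \<open>k\<close> in
  \<open>K \<inter> S\<close> the indicator comes from the common digit with high bit
  \<open>k\<close>.\<close>

lemma Int_hadamard_dual:
  "hadamard_dual m h P (A \<union> B\<^sub>1) \<inter> hadamard_dual m h P' (A \<union> B\<^sub>2) =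
   parity_check_code (2 ^ m) (insert m E) pair_check (({..<m} - S - E) <+> K) pair_even_check"
  (is "?H1 \<inter> ?H2 = ?C")
proof -
  have "u \<in> ?H1 \<and> u \<in> ?H2 \<longleftrightarrow> u \<in> ?C" for u
  proof -
    let ?d = "dot (2 ^ m) u"
    let ?bit = "\<lambda>k. ?d (\<lambda>x. abit k (P x))" and ?bit' = "\<lambda>k. ?d (\<lambda>x. abit k (P' x))"
    let ?N = "\<lambda>k. ?d (\<lambda>x. of_bool (moved m k (P x)))"
    have mE: "m \<notin> E" using bits by auto
    have C: "u \<in> ?C \<longleftrightarrow> u \<in> carrier (Z4_pow (2 ^ m)) \<and>
        (\<forall>k\<in>insert m E. 4 dvd ?d (pair_check k)) \<and>
        (\<forall>k\<in>{..<m} - S - E. even (?bit k)) \<and> (\<forall>k\<in>K. even (?N k))"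
      unfolding parity_check_code_def mem_Collect_eq Plus_def ball_Un ball_simps
      by (simp add: pair_even_check_def mod_eq_0_iff_dvd even_iff_mod_2_eq_zero[symmetric]
          del: carrier_product_group)
    have bit': "?bit' k = ?bit k" if "k < m" "k \<notin> K" for k
      using that by (simp add: abit_P')
    have check_m: "digit_check m h P' m = digit_check m h P m"
      by (simp add: fun_eq_iff digit_check_def)
    show ?thesis
    proof
      assume "u \<in> ?H1 \<and> u \<in> ?H2"
      then have u: "u \<in> carrier (Z4_pow (2 ^ m))"
        and c1: "\<And>k. k \<in> insert m (A \<union> B\<^sub>1) \<Longrightarrow> 4 dvd ?d (digit_check m h P k)"
        and e1: "\<And>k. k < m \<Longrightarrow> k \<notin> S \<union> T\<^sub>1 \<Longrightarrow> even (?bit k)"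
        and c2: "\<And>k. k \<in> insert m (A \<union> B\<^sub>2) \<Longrightarrow> 4 dvd ?d (digit_check m h P' k)"
        and e2: "\<And>k. k < m \<Longrightarrow> k \<notin> S \<union> T\<^sub>2 \<Longrightarrow> even (?bit' k)"
        unfolding first.hadamard_dual_iff second.hadamard_dual_iff high by blast+
      have "4 dvd ?d (pair_check k)" if "k \<in> insert m E" for k
        using that c1[of k] c2[of k] by (auto simp: pair_check_def)
      moreover have "even (?bit k)" if "k \<in> {..<m} - S - E" for k
      proof (cases "k \<in> T\<^sub>1")
        case True
        then have "k \<notin> S \<union> T\<^sub>2" "k \<notin> K" using that disj(4) K(2) by auto
        then show ?thesis using e2[of k] bit'[of k] that by simp
      qed (use e1 that in auto)
      moreover have "even (?N k)" if "k \<in> K" for k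
      proof (cases "k \<in> S")
        case True
        then obtain l where l: "l \<in> A" "k = h l" using K(4) \<open>k \<in> K\<close> by auto
        then have "4 dvd ?d (digit_check m h P l)" "4 dvd ?d (digit_check m h P' l)"
          using c1[of l] c2[of l] by auto
        then show ?thesis using dot_digit_check_P'[OF l(1)] l that by simp
      next
        case False
        then have "k \<notin> S \<union> T\<^sub>1" "k \<notin> S \<union> T\<^sub>2" "k < m" using that K bits by auto
        then show ?thesis using e1 e2 dot_abit_P'[OF that] by blast
      qed
      ultimately show "u \<in> ?C" unfolding C using u by blast
    next
      assume "u \<in> ?C"
      then have u: "u \<in> carrier (Z4_pow (2 ^ m))"
        and c: "\<And>k. k \<in> insert m E \<Longrightarrow> 4 dvd ?d (pair_check k)"
        and e: "\<And>k. k \<in> {..<m} - S - E \<Longrightarrow> even (?bit k)" and N: "\<And>k. k \<in> K \<Longrightarrow> even (?N k)"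
        unfolding C by blast+
      have bit_iff: "even (?bit' k) \<longleftrightarrow> even (?bit k)" if "k < m" for k
      proof (cases "k \<in> K")
        case True
        then show ?thesis using dot_abit_P'[OF True] N by blast
      qed (use bit' that in simp)
      have c1: "4 dvd ?d (digit_check m h P k)" if "k \<in> insert m (A \<union> B\<^sub>1)" for k
      proof -
        have "k \<notin> B\<^sub>2" using that mE low by auto
        then show ?thesis using c[of k] that by (auto simp: pair_check_def)
      qed
      have c2: "4 dvd ?d (digit_check m h P' k)" if "k \<in> insert m (A \<union> B\<^sub>2)" for k
      proof (cases "k \<in> A")
        case True
        then show ?thesis
          using dot_digit_check_P'[OF True c1] N by simp
      next
        case False
        then show ?thesis
          using that c[of k] mE check_m by (auto simp: pair_check_def)
      qed
      have "even (?bit k)" if "k < m" "k \<notin> S" for k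
      proof -
        consider "k \<in> A \<union> B\<^sub>1" | "k \<in> B\<^sub>2" | "k \<notin> E" by blast
        then show ?thesis
        proof cases
          case 1
          then show ?thesis using even_dot_abit[OF _ c1[of k]] that by simp
        next
          case 2
          then show ?thesis using even_dot_abit[OF _ c2[of k]] that bit_iff by simp
        qed (use e that in auto)
      qed
      then show "u \<in> ?H1 \<and> u \<in> ?H2"
        unfolding first.hadamard_dual_iff second.hadamard_dual_iff high
        using u c1 c2 bit_iff by blast
    qed
  qed
  then show ?thesis by blast
qed

lemma independent_pair_checks:
  "independent_mod_2 (2 ^ m) (insert m E) pair_check (({..<m} - S - E) <+> K) pair_even_check"
  unfolding independent_mod_2_def
proof (intro allI impI)
  fix a :: "nat \<Rightarrow> int" and c :: "nat + nat \<Rightarrow> int"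
  let ?J = "{..<m} - S - E"
  assume *: "\<forall>x<2 ^ m. even ((\<Sum>i\<in>insert m E. a i * pair_check i x) +
    (\<Sum>j\<in>?J <+> K. c j * pair_even_check j x))"
  have finE: "finite E" and finK: "finite K"
    using bits finite_subset[of _ "{..<m}"] by blast+
  have mE: "m \<notin> E" using bits by auto
  \<comment> \<open>Modulo 2 any combination of checks is a constant plus bits plus indicators, and
    these are independent. A digit with low bit in \<open>B\<^sub>2 \<inter> K\<close> is read
    through \<open>P'\<close> and brings along an indicator, hence the second summand of
    \<open>c'\<close>; it is even once \<open>a'\<close> is known to be.\<close>
  define a' where "a' k = (if k \<in> E then a k else if k \<in> ?J then c (Inl k) else 0)" for k
  define c' where "c' k = c (Inr k) + of_bool (k \<in> B\<^sub>2) * a k" for k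
  have ev: "even (a m + (\<Sum>k<m. a' k * abit k Y) + (\<Sum>k\<in>K. c' k * of_bool (moved m k Y)))"
    if "Y \<subseteq> {..<m}" for Y
  proof -
    obtain x where x: "x < 2 ^ m" "P x = Y" using first.ex_point[OF \<open>Y \<subseteq> {..<m}\<close>] .
    let ?N = "\<lambda>k. of_bool (moved m k Y) :: int"
    have "even (\<Sum>i\<in>E. a i * pair_check i x) =
        even (\<Sum>i\<in>E. a i * abit i Y + of_bool (i \<in> B\<^sub>2 \<and> i \<in> K) * (a i * ?N i))"
    proof (rule even_sum_cong)
      fix i assume i: "i \<in> E"
      then have "i < m" using bits by auto
      then have *: "even (pair_check i x) = even (abit i Y + of_bool (i \<in> B\<^sub>2 \<and> i \<in> K) * ?N i)"
        by (auto simp: pair_check_def digit_check_def abit_P' x)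
      have "a i * abit i Y + of_bool (i \<in> B\<^sub>2 \<and> i \<in> K) * (a i * ?N i) =
          a i * (abit i Y + of_bool (i \<in> B\<^sub>2 \<and> i \<in> K) * ?N i)"
        by (simp only: distrib_left mult.left_commute)
      then show "even (a i * pair_check i x) =
          even (a i * abit i Y + of_bool (i \<in> B\<^sub>2 \<and> i \<in> K) * (a i * ?N i))"
        by (simp only: even_mult_iff *)
    qed
    moreover have "(\<Sum>i\<in>E. of_bool (i \<in> B\<^sub>2 \<and> i \<in> K) * (a i * ?N i)) =
        (\<Sum>i\<in>B\<^sub>2 \<inter> K. a i * ?N i)"
      using finE by (intro sum.mono_neutral_cong_right) auto
    moreover have "(\<Sum>i\<in>K. of_bool (i \<in> B\<^sub>2) * a i * ?N i) = (\<Sum>i\<in>B\<^sub>2 \<inter> K. a i * ?N i)"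
      using finK by (intro sum.mono_neutral_cong_right) auto
    moreover have "(\<Sum>i\<in>insert m E. a i * pair_check i x) = a m + (\<Sum>i\<in>E. a i * pair_check i x)"
      using mE finE by (subst sum.insert) (auto simp: pair_check_def digit_check_def)
    moreover have "(\<Sum>j\<in>?J <+> K. c j * pair_even_check j x) =
        (\<Sum>k\<in>?J. c (Inl k) * abit k Y) + (\<Sum>k\<in>K. c (Inr k) * ?N k)"
      using finK by (subst sum.Plus) (simp_all add: pair_even_check_def x)
    moreover have "(\<Sum>k<m. a' k * abit k Y) = (\<Sum>k\<in>E. a k * abit k Y) + (\<Sum>k\<in>?J. c (Inl k) * abit k Y)"
    proof -
      have "(\<Sum>k<m. a' k * abit k Y) = (\<Sum>k\<in>E \<union> ?J. a' k * abit k Y)"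
        using bits by (intro sum.mono_neutral_right) (auto simp: a'_def)
      also have "\<dots> = (\<Sum>k\<in>E. a' k * abit k Y) + (\<Sum>k\<in>?J. a' k * abit k Y)"
        using finE by (intro sum.union_disjoint) auto
      also have "(\<Sum>k\<in>E. a' k * abit k Y) = (\<Sum>k\<in>E. a k * abit k Y)"
        by (intro sum.cong) (auto simp: a'_def)
      also have "(\<Sum>k\<in>?J. a' k * abit k Y) = (\<Sum>k\<in>?J. c (Inl k) * abit k Y)"
        by (intro sum.cong) (auto simp: a'_def)
      finally show ?thesis .
    qed
    moreover have "(\<Sum>k\<in>K. c' k * ?N k) =
        (\<Sum>k\<in>K. c (Inr k) * ?N k) + (\<Sum>k\<in>K. of_bool (k \<in> B\<^sub>2) * a k * ?N k)"
      unfolding c'_def distrib_right by (rule sum.distrib)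
    moreover note *[rule_format, OF x(1)]
    ultimately show ?thesis
      unfolding sum.distrib by (simp only: even_add) blast
  qed
  have am: "even (a m)"
    by (rule bits_and_moved_independent(1)[OF m bits(5)], erule ev)
  have a': "even (a' k)" if "k < m" for k
    by (rule bits_and_moved_independent(2)[OF m bits(5), where a = a'], erule ev, rule that)
  have c': "even (c' k)" if "k \<in> K" for k
    by (rule bits_and_moved_independent(3)[OF m bits(5), where c = c'], erule ev, rule that)
  have a: "even (a k)" if "k \<in> E" for k
    using a'[of k] that bits by (auto simp: a'_def split: if_splits)
  have "even (c (Inl k))" if "k \<in> ?J" for k
    using a'[of k] that by (auto simp: a'_def split: if_splits)
  moreover have "even (c (Inr k))" if "k \<in> K" for k
    using c'[OF that] a[of k] by (cases "k \<in> B\<^sub>2") (auto simp: c'_def)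
  ultimately show "(\<forall>i\<in>insert m E. even (a i)) \<and> (\<forall>j\<in>?J <+> K. even (c j))"
    using am a by auto
qed

lemma of_dual_type_Int_hadamard_dual:
  "of_dual_type (2 ^ m) (hadamard_dual m h P (A \<union> B\<^sub>1) \<inter> hadamard_dual m h P' (A \<union> B\<^sub>2))
     (m - card S - card E + card K) (card E + 1)"
proof -
  have fin: "finite E" "finite K" "finite S"
    using bits finite_subset[of _ "{..<m}"] by blast+
  have "card (({..<m} - S - E) <+> K) = m - card S - card E + card K"
  proof -
    have "card ({..<m} - S - E) = card ({..<m} - S) - card E"
      using bits disj fin by (intro card_Diff_subset) auto
    also have "card ({..<m} - S) = m - card S"
      using bits fin by (simp add: card_Diff_subset)
    finally show ?thesis
      using fin by (subst card_Plus) auto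
  qed
  moreover have "card (insert m E) = card E + 1"
    using fin bits by (subst card_insert_disjoint) auto
  ultimately show ?thesis
    unfolding Int_hadamard_dual
    using parity_check_code(2)[OF _ _ independent_pair_checks] fin
    by (metis finite_Diff finite_Plus finite_insert finite_lessThan)
qed

end

section \<open>Placing the bits and realizing the parameters\<close>

text \<open>Here \<open>s\<close> is the largest possible number of common high bits: the second
  code has only \<open>d\<^sub>2\<close> high bits, and common ones must avoid all
  \<open>d\<^sub>1 + d\<^sub>2 - b\<close> low bits. The two bounds on \<open>\<gamma>\<close> say
  that the required size of \<open>K\<close> lies between 0 and the number of usable
  directions.\<close>

lemma hadamard_pair_exists:
  fixes m d\<^sub>1 d\<^sub>2 b s \<gamma> :: nat
  assumes m: "3 \<le> m" and d: "d\<^sub>2 \<le> d\<^sub>1" "2 * d\<^sub>1 \<le> m" and b: "b \<le> d\<^sub>2"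
    and s: "s = min d\<^sub>2 (m + b - d\<^sub>1 - d\<^sub>2)"
    and \<gamma>: "m + b \<le> \<gamma> + s + d\<^sub>1 + d\<^sub>2" "\<gamma> + 2 * d\<^sub>1 + 2 * d\<^sub>2 \<le> 2 * m + b"
  shows "\<exists>C\<^sub>1 C\<^sub>2.
    quaternary_linear_perfect_code (m + 1) C\<^sub>1 \<and> of_dual_type (2 ^ m) C\<^sub>1 (m - 2 * d\<^sub>1) (d\<^sub>1 + 1) \<and>
    quaternary_linear_perfect_code (m + 1) C\<^sub>2 \<and> of_dual_type (2 ^ m) C\<^sub>2 (m - 2 * d\<^sub>2) (d\<^sub>2 + 1) \<and>
    of_dual_type (2 ^ m) (C\<^sub>1 \<inter> C\<^sub>2) \<gamma> (d\<^sub>1 + d\<^sub>2 - b + 1)"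
proof -
  have s': "b \<le> s" "s \<le> d\<^sub>2" "s + d\<^sub>1 + d\<^sub>2 \<le> m + b"
    using s d b by auto
  obtain P :: "nat \<Rightarrow> nat set" where P: "bij_betw P {..<2 ^ m} (Pow {..<m})"
    using finite_same_card_bij[of "{..<2 ^ m :: nat}" "Pow {..<m}"] by (auto simp: card_Pow)
  \<comment> \<open>Common low bits sit at the bottom and common high bits at the top. The other
    high bits may reuse low bits of the opposite code: \<open>T\<^sub>1\<close> starts right above
    the low bits of the first code, while \<open>T\<^sub>2\<close> fits among the low bits peculiar
    to the first code because \<open>b \<le> s\<close> and
    \<open>d\<^sub>2 \<le> d\<^sub>1\<close>.\<close>
  define T\<^sub>1 where "T\<^sub>1 = {d\<^sub>1..<2 * d\<^sub>1 - s}"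
  define T\<^sub>2 where "T\<^sub>2 = {b..<b + d\<^sub>2 - s}"
  \<comment> \<open>The usable directions: all bits outside the common low bits and all high bits,
    and in addition the \<open>b\<close> high bits paired with common low bits.\<close>
  define Q where "Q = ({b..<m - s} - T\<^sub>1 - T\<^sub>2) \<union> {m - b..<m}"
  have cardQ: "card Q = m + s - d\<^sub>1 - d\<^sub>2"
  proof -
    have T: "T\<^sub>1 \<subseteq> {b..<m - s}" "T\<^sub>2 \<subseteq> {b..<m - s} - T\<^sub>1"
      using d b s' by (auto simp: T\<^sub>1_def T\<^sub>2_def)
    have "card Q = card ({b..<m - s} - T\<^sub>1 - T\<^sub>2) + card {m - b..<m}"
      unfolding Q_def using s' by (intro card_Un_disjoint) auto
    also have "card ({b..<m - s} - T\<^sub>1 - T\<^sub>2) = card ({b..<m - s} - T\<^sub>1) - card T\<^sub>2"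
      using T(2) by (intro card_Diff_subset) (auto simp: T\<^sub>2_def)
    also have "card ({b..<m - s} - T\<^sub>1) = card {b..<m - s} - card T\<^sub>1"
      using T(1) by (intro card_Diff_subset) (auto simp: T\<^sub>1_def)
    finally show ?thesis
      using d b s' by (simp add: T\<^sub>1_def T\<^sub>2_def)
  qed
  have "\<gamma> + s + d\<^sub>1 + d\<^sub>2 - (m + b) \<le> card Q"
    unfolding cardQ using \<gamma> d by simp
  then obtain K where KQ: "K \<subseteq> Q" "card K = \<gamma> + s + d\<^sub>1 + d\<^sub>2 - (m + b)"
    by (meson obtain_subset_with_card_n)
  \<comment> \<open>The low bits of each code are ranked; the first \<open>s\<close> ranks go to the
    common high bits from \<open>m - 1\<close> downwards, the others to \<open>T\<^sub>1\<close> or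
    \<open>T\<^sub>2\<close>. In the second code a bit \<open>l \<ge> d\<^sub>1\<close> has rank
    \<open>l - d\<^sub>1 + b\<close>, after the \<open>b\<close> common ones. Since
    \<open>b \<le> s\<close>, common low bits have the same partner in both codes, so one
    \<open>h\<close> serves both.\<close>
  define h where "h l = (if l < d\<^sub>1 then if l < s then m - 1 - l else d\<^sub>1 + l - s
    else if l - d\<^sub>1 + b < s then m - 1 - (l - d\<^sub>1 + b) else b + (l - d\<^sub>1 + b) - s)" for l
  have AB1: "{..<b} \<union> {b..<d\<^sub>1} = {..<d\<^sub>1}"
    using b d by auto
  have h1: "h ` ({..<b} \<union> {b..<d\<^sub>1}) = {m - s..<m} \<union> T\<^sub>1"
  proof (intro equalityI subsetI)
    fix k assume "k \<in> {m - s..<m} \<union> T\<^sub>1"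
    then show "k \<in> h ` ({..<b} \<union> {b..<d\<^sub>1})"
    proof
      assume "k \<in> {m - s..<m}"
      then have "m - 1 - k \<in> {..<d\<^sub>1}" "h (m - 1 - k) = k"
        using s' d by (auto simp: h_def)
      then show ?thesis unfolding AB1 by (metis imageI)
    next
      assume "k \<in> T\<^sub>1"
      then have "k + s - d\<^sub>1 \<in> {..<d\<^sub>1}" "h (k + s - d\<^sub>1) = k"
        using s' d by (auto simp: h_def T\<^sub>1_def)
      then show ?thesis unfolding AB1 by (metis imageI)
    qed
  next
    fix k assume "k \<in> h ` ({..<b} \<union> {b..<d\<^sub>1})"
    then obtain l where k: "k = h l" and l: "l < d\<^sub>1" unfolding AB1 by auto
    show "k \<in> {m - s..<m} \<union> T\<^sub>1"
    proof (cases "l < s")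
      case True
      then have "k = m - 1 - l" using l by (simp add: k h_def)
      moreover have "m - s \<le> m - 1 - l" "m - 1 - l < m" using True m by linarith+
      ultimately show ?thesis by simp
    next
      case False
      then have "k = d\<^sub>1 + l - s" using l by (simp add: k h_def)
      moreover have "d\<^sub>1 \<le> d\<^sub>1 + l - s" "d\<^sub>1 + l - s < 2 * d\<^sub>1 - s"
        using l False by linarith+
      ultimately show ?thesis by (simp add: T\<^sub>1_def)
    qed
  qed
  have h2: "h ` ({..<b} \<union> {d\<^sub>1..<d\<^sub>1 + d\<^sub>2 - b}) = {m - s..<m} \<union> T\<^sub>2"
  proof (intro equalityI subsetI)
    fix k assume "k \<in> {m - s..<m} \<union> T\<^sub>2"
    then consider "k \<in> {m - b..<m}" | "k \<in> {m - s..<m - b}" | "k \<in> T\<^sub>2" by fastforce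
    then show "k \<in> h ` ({..<b} \<union> {d\<^sub>1..<d\<^sub>1 + d\<^sub>2 - b})"
    proof cases
      case 1
      then have "m - 1 - k \<in> {..<b}" "h (m - 1 - k) = k"
        using s' d b by (auto simp: h_def)
      then show ?thesis by (metis UnI1 imageI)
    next
      case 2
      then have "d\<^sub>1 + (m - 1 - k) - b \<in> {d\<^sub>1..<d\<^sub>1 + d\<^sub>2 - b}" "h (d\<^sub>1 + (m - 1 - k) - b) = k"
        using s' d b by (auto simp: h_def)
      then show ?thesis by (metis UnI2 imageI)
    next
      case 3
      then have "k + s + d\<^sub>1 - 2 * b \<in> {d\<^sub>1..<d\<^sub>1 + d\<^sub>2 - b}" "h (k + s + d\<^sub>1 - 2 * b) = k"
        using s' d b by (auto simp: h_def T\<^sub>2_def)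
      then show ?thesis by (metis UnI2 imageI)
    qed
  next
    fix k assume "k \<in> h ` ({..<b} \<union> {d\<^sub>1..<d\<^sub>1 + d\<^sub>2 - b})"
    then obtain l where k: "k = h l" and l: "l < b \<or> d\<^sub>1 \<le> l \<and> l < d\<^sub>1 + d\<^sub>2 - b" by auto
    from l consider "l < b" | "d\<^sub>1 \<le> l" "l - d\<^sub>1 + b < s" | "d\<^sub>1 \<le> l" "l < d\<^sub>1 + d\<^sub>2 - b" "s \<le> l - d\<^sub>1 + b"
      by linarith
    then show "k \<in> {m - s..<m} \<union> T\<^sub>2"
    proof cases
      case 1
      then have "k = m - 1 - l" using s' d b by (simp add: k h_def)
      moreover have "m - s \<le> m - 1 - l" "m - 1 - l < m" using 1 s' m by linarith+
      ultimately show ?thesis by simp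
    next
      case 2
      then have "k = m - 1 - (l - d\<^sub>1 + b)" by (simp add: k h_def)
      moreover have "m - s \<le> m - 1 - (l - d\<^sub>1 + b)" "m - 1 - (l - d\<^sub>1 + b) < m"
        using 2 m by linarith+
      ultimately show ?thesis by simp
    next
      case 3
      then have "k = b + (l - d\<^sub>1 + b) - s" by (simp add: k h_def)
      moreover have "b \<le> b + (l - d\<^sub>1 + b) - s" "b + (l - d\<^sub>1 + b) - s < b + d\<^sub>2 - s"
        using 3 s' d b by linarith+
      ultimately show ?thesis by (simp add: T\<^sub>2_def)
    qed
  qed
  have hA: "{m - b..<m} \<subseteq> h ` {..<b}"
  proof
    fix k assume "k \<in> {m - b..<m}"
    then have "m - 1 - k \<in> {..<b}" "h (m - 1 - k) = k"
      using s' d b by (auto simp: h_def)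
    then show "k \<in> h ` {..<b}" by (metis imageI)
  qed
  have card2: "card ({..<b} \<union> {d\<^sub>1..<d\<^sub>1 + d\<^sub>2 - b}) = d\<^sub>2"
    using d b by (subst card_Un_disjoint) auto
  interpret hadamard_pair m h P "{..<b}" "{b..<d\<^sub>1}" "{d\<^sub>1..<d\<^sub>1 + d\<^sub>2 - b}" "{m - s..<m}" T\<^sub>1 T\<^sub>2 K
  proof
    have "card ({m - s..<m} \<union> T\<^sub>1) = d\<^sub>1"
      using s' d by (subst card_Un_disjoint) (auto simp: T\<^sub>1_def)
    then show "inj_on h ({..<b} \<union> {b..<d\<^sub>1})"
      by (intro eq_card_imp_inj_on) (simp_all only: h1[unfolded AB1] AB1 card_lessThan finite_lessThan)
    have "card ({m - s..<m} \<union> T\<^sub>2) = d\<^sub>2"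
      using s' d b by (subst card_Un_disjoint) (auto simp: T\<^sub>2_def)
    then show "inj_on h ({..<b} \<union> {d\<^sub>1..<d\<^sub>1 + d\<^sub>2 - b})"
      by (intro eq_card_imp_inj_on) (simp_all only: h2 card2, simp)
    show "K \<inter> {m - s..<m} \<subseteq> h ` {..<b}"
      using KQ(1) hA by (auto simp: Q_def)
    have T1: "d\<^sub>1 \<le> k" "k < m - s" "k < m" if "k \<in> T\<^sub>1" for k
      using that s' d b by (auto simp: T\<^sub>1_def)
    have T2: "b \<le> k" "k < d\<^sub>1" "k < m - s" "k < m" if "k \<in> T\<^sub>2" for k
      using that s' d b by (auto simp: T\<^sub>2_def)
    have low_bound: "b \<le> d\<^sub>1" "d\<^sub>1 + d\<^sub>2 - b \<le> m - s"
      using s' d b by auto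
    show "{..<b} \<union> {b..<d\<^sub>1} \<union> {d\<^sub>1..<d\<^sub>1 + d\<^sub>2 - b} \<subseteq> {..<m}"
      using low_bound d by auto
    show "{m - s..<m} \<inter> ({..<b} \<union> {b..<d\<^sub>1} \<union> {d\<^sub>1..<d\<^sub>1 + d\<^sub>2 - b}) = {}"
      using low_bound b d s' by auto
    show "T\<^sub>1 \<subseteq> {..<m}" "T\<^sub>2 \<subseteq> {..<m}"
      using T1(3) T2(4) by auto
    show "T\<^sub>1 \<inter> ({..<b} \<union> {b..<d\<^sub>1}) = {}" "T\<^sub>1 \<inter> T\<^sub>2 = {}"
      using T1(1) T2(2) low_bound(1) by (fastforce dest: leD)+
    show "T\<^sub>2 \<inter> ({..<b} \<union> {d\<^sub>1..<d\<^sub>1 + d\<^sub>2 - b}) = {}"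
      using T2(1,2) by (fastforce dest: leD)
    have high_bound: "{m - b..<m} \<subseteq> {m - s..<m}" "{m - b..<m} \<inter> {..<m - s} = {}" "b \<le> m - b"
      using s' d b by auto
    have "Q \<subseteq> {b..<m}"
      using high_bound(3) by (auto simp: Q_def)
    then show "K \<subseteq> {..<m}" "K \<inter> {..<b} = {}"
      using KQ(1) by fastforce+
    show "K \<inter> T\<^sub>1 = {}" "K \<inter> T\<^sub>2 = {}"
      using KQ(1) T1(2) T2(3) high_bound(2) unfolding Q_def by blast+
    show "h ` ({..<b} \<union> {b..<d\<^sub>1}) = {m - s..<m} \<union> T\<^sub>1"
      "h ` ({..<b} \<union> {d\<^sub>1..<d\<^sub>1 + d\<^sub>2 - b}) = {m - s..<m} \<union> T\<^sub>2"
      by (rule h1, rule h2)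
  qed (use m P b d in auto)
  have E: "{..<b} \<union> {b..<d\<^sub>1} \<union> {d\<^sub>1..<d\<^sub>1 + d\<^sub>2 - b} = {..<d\<^sub>1 + d\<^sub>2 - b}"
    using d b by auto
  note card2
  moreover have "m - s - (d\<^sub>1 + d\<^sub>2 - b) + card K = \<gamma>"
    using KQ(2) \<gamma>(1) s' d b by simp
  moreover have "card ({..<b} \<union> {b..<d\<^sub>1} \<union> {d\<^sub>1..<d\<^sub>1 + d\<^sub>2 - b}) = d\<^sub>1 + d\<^sub>2 - b"
    unfolding E by simp
  moreover have "card {m - s..<m} = s"
    using s' d by simp
  ultimately show ?thesis
    using first.quaternary_linear_perfect_code_hadamard_dual first.of_dual_type_hadamard_dual
      second.quaternary_linear_perfect_code_hadamard_dual second.of_dual_type_hadamard_dual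
      of_dual_type_Int_hadamard_dual
    by (metis AB1 card_lessThan)
qed

theorem theorem7:
  fixes t \<gamma>\<^sub>1 \<gamma>\<^sub>2 \<delta>\<^sub>1 \<delta>\<^sub>2 \<gamma> \<delta> :: nat
  assumes "t \<ge> 4"
    and "\<delta>\<^sub>1 \<ge> 1" and "\<delta>\<^sub>2 \<ge> 1"
    and "\<gamma>\<^sub>1 + 2 * \<delta>\<^sub>1 = t + 1" and "\<gamma>\<^sub>2 + 2 * \<delta>\<^sub>2 = t + 1"
    and "\<delta> \<in> {max \<delta>\<^sub>1 \<delta>\<^sub>2..\<delta>\<^sub>1 + \<delta>\<^sub>2 - 1}"
    and "max \<delta> (max (\<gamma>\<^sub>1 + \<delta>\<^sub>1) (\<gamma>\<^sub>2 + \<delta>\<^sub>2)) \<le> \<gamma> + \<delta>"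
    and "\<gamma> + \<delta> \<le> \<gamma>\<^sub>1 + \<gamma>\<^sub>2 + \<delta>\<^sub>1 + \<delta>\<^sub>2 - 1"
  shows "\<exists>C\<^sub>1 C\<^sub>2.
    quaternary_linear_perfect_code t C\<^sub>1 \<and> of_dual_type (2 ^ (t - 1)) C\<^sub>1 \<gamma>\<^sub>1 \<delta>\<^sub>1 \<and>
    quaternary_linear_perfect_code t C\<^sub>2 \<and> of_dual_type (2 ^ (t - 1)) C\<^sub>2 \<gamma>\<^sub>2 \<delta>\<^sub>2 \<and>
    quaternary_linear_code (2 ^ (t - 1)) (C\<^sub>1 \<inter> C\<^sub>2) \<and>
    of_dual_type (2 ^ (t - 1)) (C\<^sub>1 \<inter> C\<^sub>2) \<gamma> \<delta>"
proof -
  \<comment> \<open>By symmetry the first \<delta> may be taken to be the larger. As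
    \<open>g + 2 * e = t + 1\<close>, the sum \<open>g + e\<close> is greatest for the smaller
    \<open>e\<close>, which selects the lower bound listed here.\<close>
  have ordered: "\<exists>C\<^sub>1 C\<^sub>2.
      quaternary_linear_perfect_code t C\<^sub>1 \<and> of_dual_type (2 ^ (t - 1)) C\<^sub>1 g\<^sub>1 e\<^sub>1 \<and>
      quaternary_linear_perfect_code t C\<^sub>2 \<and> of_dual_type (2 ^ (t - 1)) C\<^sub>2 g\<^sub>2 e\<^sub>2 \<and>
      of_dual_type (2 ^ (t - 1)) (C\<^sub>1 \<inter> C\<^sub>2) \<gamma> \<delta>"
    if "1 \<le> e\<^sub>2" "e\<^sub>2 \<le> e\<^sub>1" "g\<^sub>1 + 2 * e\<^sub>1 = t + 1" "g\<^sub>2 + 2 * e\<^sub>2 = t + 1" "e\<^sub>1 \<le> \<delta>" "\<delta> \<le> e\<^sub>1 + e\<^sub>2 - 1"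
      "g\<^sub>2 + e\<^sub>2 \<le> \<gamma> + \<delta>" "\<gamma> + \<delta> \<le> g\<^sub>1 + g\<^sub>2 + e\<^sub>1 + e\<^sub>2 - 1"
    for e\<^sub>1 e\<^sub>2 g\<^sub>1 g\<^sub>2 :: nat
  proof -
    \<comment> \<open>The all-ones check is one quaternary generator of each dual, hence the
      subtracted 1; \<open>b\<close> is solved from
      \<open>\<delta> = d\<^sub>1 + d\<^sub>2 - b + 1\<close>.\<close>
    define m d\<^sub>1 d\<^sub>2 b where "m = t - 1" "d\<^sub>1 = e\<^sub>1 - 1" "d\<^sub>2 = e\<^sub>2 - 1" "b = e\<^sub>1 + e\<^sub>2 - 1 - \<delta>"
    note defs = this
    have eqs: "t = m + 1" "e\<^sub>1 = d\<^sub>1 + 1" "e\<^sub>2 = d\<^sub>2 + 1" "g\<^sub>1 = m - 2 * d\<^sub>1" "g\<^sub>2 = m - 2 * d\<^sub>2"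
      "\<delta> = d\<^sub>1 + d\<^sub>2 - b + 1"
      using that assms(1) by (auto simp: defs)
    \<comment> \<open>Where the minimum is \<open>d\<^sub>2\<close>, the lower bound on
      \<open>\<gamma>\<close> is \<open>g\<^sub>2 + e\<^sub>2 \<le> \<gamma> + \<delta>\<close>; in
      the other case it reduces to \<open>0 \<le> \<gamma>\<close>.\<close>
    have "3 \<le> m" "d\<^sub>2 \<le> d\<^sub>1" "2 * d\<^sub>1 \<le> m" "b \<le> d\<^sub>2"
      "m + b \<le> \<gamma> + min d\<^sub>2 (m + b - d\<^sub>1 - d\<^sub>2) + d\<^sub>1 + d\<^sub>2" "\<gamma> + 2 * d\<^sub>1 + 2 * d\<^sub>2 \<le> 2 * m + b"
      using that assms(1) by (auto simp: defs)
    from hadamard_pair_exists[OF this(1-4) refl this(5,6)] show ?thesis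
      by (simp add: eqs)
  qed
  have "\<exists>C\<^sub>1 C\<^sub>2.
      quaternary_linear_perfect_code t C\<^sub>1 \<and> of_dual_type (2 ^ (t - 1)) C\<^sub>1 \<gamma>\<^sub>1 \<delta>\<^sub>1 \<and>
      quaternary_linear_perfect_code t C\<^sub>2 \<and> of_dual_type (2 ^ (t - 1)) C\<^sub>2 \<gamma>\<^sub>2 \<delta>\<^sub>2 \<and>
      of_dual_type (2 ^ (t - 1)) (C\<^sub>1 \<inter> C\<^sub>2) \<gamma> \<delta>"
  proof (cases "\<delta>\<^sub>2 \<le> \<delta>\<^sub>1")
    case True
    then show ?thesis
      using assms by (intro ordered) auto
  next
    case False
    then have "\<exists>C\<^sub>2 C\<^sub>1.
        quaternary_linear_perfect_code t C\<^sub>2 \<and> of_dual_type (2 ^ (t - 1)) C\<^sub>2 \<gamma>\<^sub>2 \<delta>\<^sub>2 \<and>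
        quaternary_linear_perfect_code t C\<^sub>1 \<and> of_dual_type (2 ^ (t - 1)) C\<^sub>1 \<gamma>\<^sub>1 \<delta>\<^sub>1 \<and>
        of_dual_type (2 ^ (t - 1)) (C\<^sub>2 \<inter> C\<^sub>1) \<gamma> \<delta>"
      using assms by (intro ordered) auto
    then show ?thesis
      by (metis Int_commute)
  qed
  then show ?thesis
    unfolding of_dual_type_def by blast
qed

end
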